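(* Assume $\omega_i/\omega\notin\mathbb{Z}$ for $i=1,\dots,n$. Then the exact, third-order reduced model of the system $$\ddot x+\omega^2x+P(x,\mathbf{y})=0,\qquad \mathbf{M}\ddot{\mathbf{y}}+\mathbf{K}\mathbf{y}+\mathbf{Q}(x,\mathbf{y})=\mathbf{0}$$ on its Lyapunov subcenter manifold $\mathcal{W}$ (that is, the equation $\ddot x+\omega^2x+P(x,\mathbf{w}(x,\dot x))+\mathcal{O}(|(x,\dot x)|^4)=0$ obtained by substituting $\mathbf{y}=\mathbf{w}(x,\dot x)$ into the first equation) takes the form $$\ddot x+\omega^2x+p_{2\mathbf{0}}x^2+\left(p_{3\mathbf{0}}+\langle\mathbf{p}_{1\mathbf{I}},\mathbf{w}_{20}\rangle\right)x^3+\langle\mathbf{p}_{1\mathbf{I}},\mathbf{w}_{02}\rangle\,x\dot x^2+\mathcal{O}(|(x,\dot x)|^4)=0,$$ where $$\mathbf{w}_{20}=-\left(\boldsymbol{\Omega}_{\mathrm p}^2-2\omega^2\mathbf{I}\right)\left(\boldsymbol{\Omega}_{\mathrm p}^2-4\omega^2\mathbf{I}\right)^{-1}\boldsymbol{\Omega}_{\mathrm p}^{-2}\mathbf{M}^{-1}\mathbf{q}_{2\mathbf{0}},\qquad \mathbf{w}_{02}=2\left(\boldsymbol{\Omega}_{\mathrm p}^2-4\omega^2\mathbf{I}\right)^{-1}\boldsymbol{\Omega}_{\mathrm p}^{-2}\mathbf{M}^{-1}\mathbf{q}_{2\mathbf{0}}.$$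
   Context: Setting: a conservative (undamped, autonomous) mechanical system with $n+1$ degrees of freedom; $x\in\mathbb{R}$ and $\mathbf{y}\in\mathbb{R}^n$. $\mathbf{M}$ and $\mathbf{K}$ are the real $n\times n$ mass and stiffness matrices ($\mathbf{M}$ invertible), $\omega>0$ is the natural frequency of the $x$-mode, and $\boldsymbol{\Omega}_{\mathrm p}^2:=\mathbf{M}^{-1}\mathbf{K}$, $\boldsymbol{\Omega}_{\mathrm p}^{-2}:=(\boldsymbol{\Omega}_{\mathrm p}^2)^{-1}$. The linearized $\mathbf{y}$-equation has the purely imaginary eigenvalues $\pm\mathrm{i}\omega_1,\dots,\pm\mathrm{i}\omega_n$ (so the eigenvalues of $\boldsymbol{\Omega}_{\mathrm p}^2$ are $\omega_1^2,\dots,\omega_n^2$), with natural frequencies $\omega_k$. $P$ and $\mathbf{Q}$ are polynomials of degree at most $l$, $2\le l\le 3$, without constant and linear terms: $$P(x,\mathbf{y})=\sum_{j+|\mathbf{k}|=2}^{l}p_{j\mathbf{k}}x^jy_1^{k_1}\cdots y_n^{k_n},\qquad \mathbf{Q}(x,\mathbf{y})=\sum_{j+|\mathbf{k}|=2}^{l}\mathbf{q}_{j\mathbf{k}}x^jy_1^{k_1}\cdots y_n^{k_n},$$ $p_{j\mathbf{k}}\in\mathbb{R}$, $\mathbf{q}_{j\mathbf{k}}\in\mathbb{R}^n$, $\mathbf{k}\in\mathbb{N}^n$ (with $0\in\mathbb{N}$; coefficients of order higher than $l$ are zero). $\mathbf{0}\in\mathbb{N}^n$ is the zero index, $\mathbf{e}_j\in\mathbb{N}^n$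 the $j$-th unit index, and $\mathbf{p}_{1\mathbf{I}}:=[p_{1\mathbf{e}_1},\dots,p_{1\mathbf{e}_n}]^\top\in\mathbb{R}^n$. $\langle\cdot,\cdot\rangle$ is the Euclidean inner product and $\mathbf{I}$ the identity matrix. Lyapunov subcenter manifold (LSM): it is known (Kelley) that if $\omega_i/\omega\notin\mathbb{Z}$ for all $i$, there is (near the origin) a unique, analytic, two-dimensional invariant manifold $\mathcal{W}=\{(x,\dot x,\mathbf{y},\dot{\mathbf{y}})\in\mathbb{R}^{2n+2}:\ \mathbf{y}=\mathbf{w}(x,\dot x),\ \dot{\mathbf{y}}=\dot{\mathbf{w}}(x,\dot x)\}$ of the system, tangent to the subspace $\mathbf{y}=\dot{\mathbf{y}}=\mathbf{0}$ at the trivial fixed point; here $\dot{\mathbf{w}}$ is the time derivative of $\mathbf{w}$ along trajectories in $\mathcal{W}$. Its Taylor expansion is $\mathbf{w}(x,\dot x)=\sum_{i+j\in\{2,3\}}\mathbf{w}_{ij}x^i\dot x^j+\mathcal{O}(|(x,\dot x)|^4)$. *)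

theory Defs
  imports "HOL-Analysis.Analysis" "HOL-Library.Landau_Symbols"
begin

section \<open>Polynomials in one scalar and one vector variable\<close>

text \<open>The coefficients \<open>c j k\<close> may be scalars or vectors. Only those of order
  \<open>2 \<le> j + |k| \<le> l\<close> enter, so there are no constant and no linear terms.\<close>

definition mdeg :: "('n::finite \<Rightarrow> nat) \<Rightarrow> nat" where
  "mdeg k = (\<Sum>i\<in>UNIV. k i)"

definition unit_index :: "'n::finite \<Rightarrow> 'n \<Rightarrow> nat" where
  "unit_index j = (\<lambda>i. if i = j then 1 else 0)"

definition poly_xy ::
  "nat \<Rightarrow> (nat \<Rightarrow> ('n::finite \<Rightarrow> nat) \<Rightarrow> 'b::real_vector) \<Rightarrow> real \<Rightarrow> real ^ 'n \<Rightarrow> 'b" where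
  "poly_xy l c x y =
     (\<Sum>(j, k) \<in> {(j, k). 2 \<le> j + mdeg k \<and> j + mdeg k \<le> l}.
        (x ^ j * (\<Prod>i\<in>UNIV. (y $ i) ^ k i)) *\<^sub>R c j k)"


section \<open>Eigenvalues\<close>

text \<open>The family \<open>ev\<close> lists the eigenvalues of \<open>A\<close> with algebraic multiplicity, i.e. the
  characteristic polynomial of \<open>A\<close> splits with roots \<open>ev\<close> (a polynomial identity, hence it
  suffices to state it at real arguments).\<close>

definition eigenvalues_are :: "real ^ 'n ^ 'n \<Rightarrow> ('n::finite \<Rightarrow> real) \<Rightarrow> bool" where
  "eigenvalues_are A ev \<longleftrightarrow> (\<forall>z. det (mat z - A) = (\<Prod>i\<in>UNIV. z - ev i))"


section \<open>Real-analytic functions of two variables\<close>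

definition real_analytic2_on ::
  "(real \<times> real \<Rightarrow> 'b::real_normed_vector) \<Rightarrow> (real \<times> real) set \<Rightarrow> bool" where
  "real_analytic2_on f U \<longleftrightarrow>
     (\<forall>(a, b) \<in> U. \<exists>r>0. \<exists>c :: nat \<Rightarrow> nat \<Rightarrow> 'b. \<forall>x v. \<bar>x - a\<bar> < r \<and> \<bar>v - b\<bar> < r \<longrightarrow>
        ((\<lambda>(i, j). ((x - a) ^ i * (v - b) ^ j) *\<^sub>R c i j) has_sum f (x, v)) UNIV)"

text \<open>The coefficient of \<open>x\<^sup>i v\<^sup>j\<close> in the Taylor expansion at the origin.\<close>

definition taylor_coeff :: "(real \<times> real \<Rightarrow> real ^ 'n) \<Rightarrow> nat \<Rightarrow> nat \<Rightarrow> real ^ 'n" where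
  "taylor_coeff f i j =
     (\<chi> m. (deriv ^^ i) (\<lambda>x. (deriv ^^ j) (\<lambda>v. f (x, v) $ m) 0) 0 / (fact i * fact j))"


section \<open>The mechanical system\<close>

text \<open>Phase space points are ordered as \<open>(x, v, y, u)\<close> with \<open>v\<close> and \<open>u\<close> the velocities of
  \<open>x\<close> and \<open>y\<close>; below, \<open>a\<close> and \<open>b\<close> are the corresponding accelerations.\<close>

type_synonym 'n phase = "real \<times> real \<times> (real ^ 'n) \<times> (real ^ 'n)"

definition trajectory_on ::
  "real \<Rightarrow> (real \<Rightarrow> real ^ 'n \<Rightarrow> real) \<Rightarrow> real ^ 'n ^ 'n \<Rightarrow> real ^ 'n ^ 'n \<Rightarrow>
   (real \<Rightarrow> real ^ 'n \<Rightarrow> real ^ 'n) \<Rightarrow> real set \<Rightarrow> (real \<Rightarrow> ('n::finite) phase) \<Rightarrow> bool" where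
  "trajectory_on \<omega> P M K Q I \<gamma> \<longleftrightarrow>
     (\<exists>x v y u. \<gamma> = (\<lambda>t. (x t, v t, y t, u t)) \<and>
       (\<forall>t\<in>I. \<exists>a b.
          (x has_real_derivative v t) (at t) \<and> (v has_real_derivative a) (at t) \<and>
          (y has_vector_derivative u t) (at t) \<and> (u has_vector_derivative b) (at t) \<and>
          a + \<omega>\<^sup>2 * x t + P (x t) (y t) = 0 \<and>
          M *v b + K *v y t + Q (x t) (y t) = 0))"

text \<open>Local invariance: the trajectory through any point of \<open>W\<close> stays in \<open>W\<close> for a short time.
  For invertible \<open>M\<close> and polynomial \<open>P\<close>, \<open>Q\<close> this trajectory exists and is unique.\<close>

definition locally_invariant ::
  "real \<Rightarrow> (real \<Rightarrow> real ^ 'n \<Rightarrow> real) \<Rightarrow> real ^ 'n ^ 'n \<Rightarrow> real ^ 'n ^ 'n \<Rightarrow>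
   (real \<Rightarrow> real ^ 'n \<Rightarrow> real ^ 'n) \<Rightarrow> ('n::finite) phase set \<Rightarrow> bool" where
  "locally_invariant \<omega> P M K Q W \<longleftrightarrow>
     (\<forall>z\<in>W. \<exists>\<epsilon>>0. \<exists>\<gamma>. \<gamma> 0 = z \<and> trajectory_on \<omega> P M K Q {-\<epsilon><..<\<epsilon>} \<gamma> \<and>
        (\<forall>t\<in>{-\<epsilon><..<\<epsilon>}. \<gamma> t \<in> W))"


section \<open>Lyapunov subcenter manifolds\<close>

text \<open>The time derivative of \<open>w (x, x')\<close> along trajectories with \<open>y = w (x, x')\<close>, by the chain
  rule with \<open>x'' = - \<omega>\<^sup>2 x - P (x, w (x, x'))\<close>.\<close>

definition time_deriv ::
  "real \<Rightarrow> (real \<Rightarrow> real ^ 'n \<Rightarrow> real) \<Rightarrow> (real \<times> real \<Rightarrow> real ^ ('n::finite)) \<Rightarrow>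
   real \<times> real \<Rightarrow> real ^ 'n" where
  "time_deriv \<omega> P w =
     (\<lambda>(x, v). frechet_derivative w (at (x, v)) (v, - \<omega>\<^sup>2 * x - P x (w (x, v))))"

definition lsm_set ::
  "real \<Rightarrow> (real \<Rightarrow> real ^ 'n \<Rightarrow> real) \<Rightarrow> (real \<times> real) set \<Rightarrow>
   (real \<times> real \<Rightarrow> real ^ ('n::finite)) \<Rightarrow> 'n phase set" where
  "lsm_set \<omega> P U w =
     {(x, v, y, u). (x, v) \<in> U \<and> y = w (x, v) \<and> u = time_deriv \<omega> P w (x, v)}"

text \<open>\<open>w\<close> parametrizes, over the neighbourhood \<open>U\<close> of the origin, an analytic invariant manifold
  through the fixed point \<open>0\<close> that is tangent there to the subspace \<open>y = u = 0\<close>.\<close>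

definition is_LSM ::
  "real \<Rightarrow> (real \<Rightarrow> real ^ 'n \<Rightarrow> real) \<Rightarrow> real ^ 'n ^ 'n \<Rightarrow> real ^ 'n ^ 'n \<Rightarrow>
   (real \<Rightarrow> real ^ 'n \<Rightarrow> real ^ 'n) \<Rightarrow> (real \<times> real) set \<Rightarrow>
   (real \<times> real \<Rightarrow> real ^ ('n::finite)) \<Rightarrow> bool" where
  "is_LSM \<omega> P M K Q U w \<longleftrightarrow>
     open U \<and> (0, 0) \<in> U \<and> real_analytic2_on w U \<and>
     locally_invariant \<omega> P M K Q (lsm_set \<omega> P U w) \<and>
     w (0, 0) = 0 \<and> time_deriv \<omega> P w (0, 0) = 0 \<and>
     ((\<lambda>z. (w z, time_deriv \<omega> P w z)) has_derivative (\<lambda>_. 0)) (at (0, 0))"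

text \<open>The equation for the acceleration \<open>a\<close> at the point \<open>(x, v)\<close> obtained by substituting
  \<open>y = w (x, v)\<close> into the first equation of motion.\<close>

definition reduced_model ::
  "real \<Rightarrow> (real \<Rightarrow> real ^ 'n \<Rightarrow> real) \<Rightarrow> (real \<times> real \<Rightarrow> real ^ ('n::finite)) \<Rightarrow>
   real \<Rightarrow> real \<Rightarrow> real \<Rightarrow> bool" where
  "reduced_model \<omega> P w x v a \<longleftrightarrow> a + \<omega>\<^sup>2 * x + P x (w (x, v)) = 0"

end

theory Submission
  imports Defs
begin

text \<open>Near the origin write \<open>w = x\<^sup>2 w20 + x v w11 + v\<^sup>2 w02\<close> plus terms of third order; the constant and linear
  terms vanish because the manifold is tangent to \<open>y = y' = 0\<close>. Let \<open>D\<close> denote the time derivative along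
  the manifold. Invariance means that \<open>w\<close> evaluated along a trajectory solves the second equation of motion,
  \<open>M (D (D w)) + K w + Q (x, w) = 0\<close> (lemma \<open>invariance_equation\<close>). To second order, \<open>D\<close> is the linear
  operator with \<open>D x = v\<close> and \<open>D v = - \<omega>\<^sup>2 x\<close>, and \<open>Q (x, w)\<close> is \<open>x\<^sup>2\<close> times its leading coefficient
  (lemma \<open>LSM_quadratic_equation\<close>). With \<open>A\<close> the matrix \<open>\<Omega>2\<close> and \<open>m\<close> the product of the inverse of \<open>M\<close> with
  the coefficient of \<open>x\<^sup>2\<close> in \<open>Q\<close>, comparing coefficients of \<open>x\<^sup>2\<close>, \<open>x v\<close> and \<open>v\<^sup>2\<close> gives

  \<^item> \<open>A w20 - 2 \<omega>\<^sup>2 w20 + 2 \<omega>\<^sup>4 w02 + m = 0\<close>,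
  \<^item> \<open>A w11 - 4 \<omega>\<^sup>2 w11 = 0\<close>,
  \<^item> \<open>A w02 - 2 \<omega>\<^sup>2 w02 + 2 w20 = 0\<close>.

  Nonresonance makes \<open>A\<close> and \<open>A - 4 \<omega>\<^sup>2\<close> invertible, so \<open>w11 = 0\<close>, and the other two equations have the stated
  solution (lemma \<open>quadratic_coefficient_system\<close>).

  For the reduced model, \<open>y = w (x, v)\<close> is of second order, so that only the monomials \<open>x\<^sup>2\<close>, \<open>x ^ 3\<close> and
  \<open>x * y $ i\<close> of \<open>P\<close> contribute below order four (lemma \<open>poly_xy_on_graph\<close>). In the mixed monomials \<open>w\<close> may be
  replaced by its quadratic part, which produces \<open>x ^ 3\<close> and \<open>x * v\<^sup>2\<close>, but no \<open>x\<^sup>2 * v\<close> since \<open>w11 = 0\<close>.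

  The analytic input is that a convergent double power series is differentiable term by term, so that \<open>w\<close> is
  twice differentiable on a whole neighbourhood of the origin and its remainders have the expected order
  (lemmas \<open>power_series2_has_derivative\<close> and \<open>power_series2_order\<close>).\<close>

section \<open>Double power series\<close>

text \<open>The square of half-width \<open>r\<close> is fixed once and for all: differentiation does not shrink it, so all
  derivatives of \<open>w\<close> are available on one common square.\<close>

definition power_series2 ::
  "(nat \<Rightarrow> nat \<Rightarrow> 'b::banach) \<Rightarrow> real \<Rightarrow> (real \<times> real \<Rightarrow> 'b) \<Rightarrow> bool" where
  "power_series2 c r f \<longleftrightarrow> (\<forall>x v. \<bar>x\<bar> < r \<and> \<bar>v\<bar> < r \<longrightarrow>
     ((\<lambda>(i, j). (x ^ i * v ^ j) *\<^sub>R c i j) has_sum f (x, v)) UNIV)"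

text \<open>Term-by-term differentiation and the boundedness of the terms are statements about sequences of
  functions; enumerating the pairs of indices reduces double series to them.\<close>

lemma has_sum_prod_decode_sums:
  assumes "(g has_sum s) (UNIV :: (nat \<times> nat) set)"
  shows "(\<lambda>n. g (prod_decode n)) sums s"
proof -
  have "((g \<circ> prod_decode) has_sum s) UNIV"
    using assms has_sum_reindex[of prod_decode UNIV g s] by (simp add: inj_prod_decode surj_prod_decode)
  then show ?thesis
    using has_sum_imp_sums by (force simp: o_def)
qed

lemma summable_on_Suc_geometric2:
  fixes q :: real
  assumes "0 \<le> q" "q < 1"
  shows "(\<lambda>(i, j). (real (Suc i) * q ^ i) * (real (Suc j) * q ^ j)) summable_on UNIV"
proof -
  have *: "((\<lambda>i. real (Suc i) * q ^ i) has_sum (1 / (1 - q)\<^sup>2)) UNIV"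
    using geometric_deriv_sums[of q] assms by (intro sums_nonneg_imp_has_sum) auto
  have "(\<lambda>(i, j). (real (Suc i) * q ^ i) * (real (Suc j) * q ^ j)) summable_on (SIGMA i:UNIV. UNIV)"
  proof (rule summable_on_SigmaI)
    show "((\<lambda>j. case (i, j) of (i, j) \<Rightarrow> (real (Suc i) * q ^ i) * (real (Suc j) * q ^ j)) has_sum
       (real (Suc i) * q ^ i) * (1 / (1 - q)\<^sup>2)) UNIV" for i
      using has_sum_cmult_right[OF *] by simp
    show "(\<lambda>i. (real (Suc i) * q ^ i) * (1 / (1 - q)\<^sup>2)) summable_on UNIV"
      by (rule summable_on_cmult_left[OF has_sum_imp_summable[OF *]])
  qed (use assms in auto)
  then show ?thesis by simp
qed

text \<open>Convergence at a point \<open>(\<sigma>, \<sigma>)\<close> with \<open>\<rho> < \<sigma> < r\<close> bounds the numbers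
  \<open>\<sigma> ^ (i + j) * norm (c i j)\<close>, and the remaining factor \<open>(\<rho> / \<sigma>) ^ (i + j)\<close> beats any polynomial. The
  weight \<open>Suc (i + j)\<close> makes the same majorant serve the series and its two partial derivatives.\<close>

lemma power_series2_majorant:
  fixes c :: "nat \<Rightarrow> nat \<Rightarrow> 'b::banach"
  assumes f: "power_series2 c r f" and \<rho>: "0 < \<rho>" "\<rho> < r"
  shows "(\<lambda>(i, j). real (Suc (i + j)) * \<rho> ^ (i + j) * norm (c i j)) summable_on UNIV"
proof -
  define \<sigma> where "\<sigma> = (\<rho> + r) / 2"
  have \<sigma>: "\<rho> < \<sigma>" "\<sigma> < r" using \<rho> by (auto simp: \<sigma>_def)
  define q where "q = \<rho> / \<sigma>"
  have q: "0 \<le> q" "q < 1" using \<rho> \<sigma> by (auto simp: q_def)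
  have "((\<lambda>(i, j). (\<sigma> ^ i * \<sigma> ^ j) *\<^sub>R c i j) has_sum f (\<sigma>, \<sigma>)) UNIV"
    using f \<rho> \<sigma> by (auto simp: power_series2_def)
  then have "summable (\<lambda>n. case prod_decode n of (i, j) \<Rightarrow> (\<sigma> ^ i * \<sigma> ^ j) *\<^sub>R c i j)"
    by (rule sums_summable[OF has_sum_prod_decode_sums])
  then obtain B where B: "B > 0" "\<And>n. norm (case prod_decode n of (i, j) \<Rightarrow> (\<sigma> ^ i * \<sigma> ^ j) *\<^sub>R c i j) \<le> B"
    using summable_imp_Bseq by (meson BseqE)
  have bound: "\<sigma> ^ (i + j) * norm (c i j) \<le> B" for i j
    using B(2)[of "prod_encode (i, j)"] \<rho> \<sigma> by (simp add: abs_mult power_add)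
  have le: "real (Suc (i + j)) * \<rho> ^ (i + j) * norm (c i j)
      \<le> B * ((real (Suc i) * q ^ i) * (real (Suc j) * q ^ j))" for i j
  proof -
    have "\<rho> ^ (i + j) * norm (c i j) = q ^ (i + j) * (\<sigma> ^ (i + j) * norm (c i j))"
      using \<rho> \<sigma> by (simp add: q_def power_divide)
    also have "\<dots> \<le> q ^ (i + j) * B"
      using bound q by (intro mult_left_mono) auto
    finally have 1: "\<rho> ^ (i + j) * norm (c i j) \<le> q ^ (i + j) * B" .
    have 2: "real (Suc (i + j)) \<le> real (Suc i) * real (Suc j)"
      by (simp add: algebra_simps)
    have "real (Suc (i + j)) * (\<rho> ^ (i + j) * norm (c i j))
        \<le> (real (Suc i) * real (Suc j)) * (q ^ (i + j) * B)"
      using \<rho> by (intro mult_mono[OF 2 1]) auto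
    then show ?thesis by (simp add: power_add mult_ac)
  qed
  have "(\<lambda>(i, j). B * ((real (Suc i) * q ^ i) * (real (Suc j) * q ^ j))) summable_on UNIV"
    using summable_on_cmult_right[OF summable_on_Suc_geometric2[OF q], of B] by (simp add: case_prod_unfold)
  then show ?thesis
    by (rule summable_on_comparison_test) (use le \<rho> in auto)
qed

lemma power_series2_at_0:
  assumes "power_series2 c r f" "0 < r"
  shows "f (0, 0) = c 0 0"
proof -
  have "((\<lambda>(i, j). (0 ^ i * 0 ^ j) *\<^sub>R c i j) has_sum f (0, 0)) UNIV"
    using assms by (auto simp: power_series2_def)
  moreover have "((\<lambda>(i, j). ((0::real) ^ i * 0 ^ j) *\<^sub>R c i j) has_sum c 0 0) UNIV \<longleftrightarrow>
      ((\<lambda>(i, j). ((0::real) ^ i * 0 ^ j) *\<^sub>R c i j) has_sum c 0 0) {(0, 0)}"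
    by (rule has_sum_cong_neutral) (auto simp: power_0_left split: if_splits)
  ultimately show ?thesis
    by (simp add: has_sum_unique has_sum_finiteI)
qed

text \<open>For \<open>norm z = t < \<rho>\<close> each surviving term gains a factor \<open>(t / \<rho>) ^ k\<close> over the convergent majorant at
  radius \<open>\<rho>\<close>.\<close>

lemma power_series2_order:
  fixes c :: "nat \<Rightarrow> nat \<Rightarrow> 'b::banach"
  assumes f: "power_series2 c r f" and r: "0 < r"
    and low: "\<And>i j. i + j < k \<Longrightarrow> c i j = 0"
  shows "\<exists>C \<delta>. \<delta> > 0 \<and> (\<forall>z. norm z < \<delta> \<longrightarrow> norm (f z) \<le> C * norm z ^ k)"
proof -
  define \<rho> where "\<rho> = r / 2"
  have \<rho>: "0 < \<rho>" "\<rho> < r" using r by (auto simp: \<rho>_def)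
  let ?m = "\<lambda>(i, j). real (Suc (i + j)) * \<rho> ^ (i + j) * norm (c i j)"
  have m: "?m summable_on UNIV" by (rule power_series2_majorant[OF f \<rho>])
  define C where "C = infsum ?m UNIV / \<rho> ^ k"
  have "norm (f (x, v)) \<le> C * norm (x, v) ^ k" if z: "norm (x, v) < \<rho>" for x v
  proof -
    define t where "t = norm (x, v)"
    have t: "\<bar>x\<bar> \<le> t" "\<bar>v\<bar> \<le> t" "0 \<le> t" "t < \<rho>"
      using norm_fst_le[of x v] norm_snd_le[of v x] z by (auto simp: t_def)
    have le: "norm ((x ^ i * v ^ j) *\<^sub>R c i j) \<le> (t / \<rho>) ^ k * ?m (i, j)" for i j
    proof (cases "i + j < k")
      case True
      then show ?thesis by (simp add: low)
    next
      case False
      have "\<bar>x\<bar> ^ i * \<bar>v\<bar> ^ j \<le> t ^ i * t ^ j"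
        using t by (intro mult_mono power_mono) auto
      also have "\<dots> = (t / \<rho>) ^ (i + j) * \<rho> ^ (i + j)"
        using \<rho> by (simp add: power_divide power_add)
      also have "\<dots> \<le> (t / \<rho>) ^ k * (real (Suc (i + j)) * \<rho> ^ (i + j))"
        using False t \<rho> by (intro mult_mono power_decreasing) (auto simp: mult_le_cancel_right1)
      finally have "\<bar>x\<bar> ^ i * \<bar>v\<bar> ^ j * norm (c i j)
          \<le> (t / \<rho>) ^ k * (real (Suc (i + j)) * \<rho> ^ (i + j)) * norm (c i j)"
        by (rule mult_right_mono) simp
      then show ?thesis
        by (simp add: abs_mult power_abs mult.assoc)
    qed
    have 1: "((\<lambda>p. (t / \<rho>) ^ k * ?m p) has_sum (t / \<rho>) ^ k * infsum ?m UNIV) UNIV"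
      using m by (intro has_sum_cmult_right) auto
    have "(\<lambda>(i, j). norm ((x ^ i * v ^ j) *\<^sub>R c i j)) summable_on UNIV"
      using has_sum_imp_summable[OF 1]
      by (rule summable_on_comparison_test) (use le in auto)
    then have 2: "((\<lambda>p. norm (case p of (i, j) \<Rightarrow> (x ^ i * v ^ j) *\<^sub>R c i j)) has_sum
        infsum (\<lambda>p. norm (case p of (i, j) \<Rightarrow> (x ^ i * v ^ j) *\<^sub>R c i j)) UNIV) UNIV"
      by (intro has_sum_infsum) (simp add: case_prod_unfold)
    have "norm (f (x, v)) \<le> infsum (\<lambda>p. norm (case p of (i, j) \<Rightarrow> (x ^ i * v ^ j) *\<^sub>R c i j)) UNIV"
      using f t \<rho> by (intro norm_has_sum_bound[OF 2]) (auto simp: power_series2_def)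
    also have "\<dots> \<le> (t / \<rho>) ^ k * infsum ?m UNIV"
      using le by (intro has_sum_mono[OF 2 1]) auto
    finally show ?thesis by (simp add: C_def t_def power_divide mult_ac)
  qed
  then show ?thesis using \<rho>(1) by - (rule exI[of _ C], rule exI[of _ \<rho>], auto)
qed

text \<open>A summable majorant of the derivatives makes their partial sums converge uniformly, which is the
  hypothesis of term-by-term differentiation.\<close>

lemma has_derivative_series_majorized:
  fixes f :: "nat \<Rightarrow> 'a::real_normed_vector \<Rightarrow> 'b::banach"
  assumes S: "open S" "convex S"
    and f': "\<And>n x. x \<in> S \<Longrightarrow> (f n has_derivative f' n x) (at x)"
    and M: "summable M" "\<And>n x h. x \<in> S \<Longrightarrow> norm (f' n x h) \<le> M n * norm h"
    and g': "\<And>x h. x \<in> S \<Longrightarrow> (\<lambda>n. f' n x h) sums g' x h"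
    and g: "\<And>x. x \<in> S \<Longrightarrow> (\<lambda>n. f n x) sums g x"
    and x: "x \<in> S"
  shows "(g has_derivative g' x) (at x)"
proof -
  have ev: "\<forall>\<^sub>F n in sequentially. \<forall>x\<in>S. \<forall>h. norm (sum (\<lambda>i. f' i x h) {..<n} - g' x h) \<le> e * norm h"
    if "e > 0" for e
  proof -
    have "(\<lambda>n. suminf (\<lambda>i. M (i + n))) \<longlonglongrightarrow> 0"
      by (rule suminf_exist_split2[OF M(1)])
    then have "\<forall>\<^sub>F n in sequentially. suminf (\<lambda>i. M (i + n)) < e"
      using that by (rule order_tendstoD)
    then show ?thesis
    proof eventually_elim
      case (elim n)
      show ?case
      proof (intro ballI allI)
        fix x h assume "x \<in> S"
        have tail: "(\<lambda>i. f' (i + n) x h) sums (g' x h - (\<Sum>i<n. f' i x h))"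
          using g'[OF \<open>x \<in> S\<close>, of h] sums_iff_shift[of "\<lambda>i. f' i x h" n] by auto
        have Ms: "summable (\<lambda>i. M (i + n) * norm h)"
          using M(1) by (intro summable_mult2) (simp add: summable_iff_shift)
        have "norm (g' x h - (\<Sum>i<n. f' i x h)) \<le> suminf (\<lambda>i. M (i + n) * norm h)"
          unfolding sums_unique[OF tail] by (rule norm_suminf_le[OF M(2)[OF \<open>x \<in> S\<close>] Ms])
        also have "\<dots> = suminf (\<lambda>i. M (i + n)) * norm h"
          using M(1) by (intro suminf_mult2[symmetric]) (simp add: summable_iff_shift)
        also have "\<dots> \<le> e * norm h"
          using elim by (intro mult_right_mono) auto
        finally show "norm (sum (\<lambda>i. f' i x h) {..<n} - g' x h) \<le> e * norm h"
          by (simp add: norm_minus_commute)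
      qed
    qed
  qed
  have "\<exists>G. \<forall>y\<in>S. (\<lambda>n. f n y) sums G y \<and> (G has_derivative g' y) (at y within S)"
    by (rule has_derivative_series[where f = f and f' = f' and g' = g', OF S(2) _ ev x g[OF x]])
      (rule has_derivative_at_withinI[OF f'])
  then obtain G where G: "\<And>y. y \<in> S \<Longrightarrow> (\<lambda>n. f n y) sums G y"
      "\<And>y. y \<in> S \<Longrightarrow> (G has_derivative g' y) (at y within S)"
    by blast
  have eq: "g y = G y" if "y \<in> S" for y
    using g[OF that] G(1)[OF that] by (rule sums_unique2)
  have "(g has_derivative g' x) (at x within S)"
    by (rule has_derivative_transform[where f = G and s = S, OF x _ G(2)[OF x]]) (rule eq)
  then show ?thesis unfolding at_within_open[OF x S(1)] .
qed

text \<open>Since the partial derivatives are double power series on the same square, the lemma can be applied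
  to them again; this is how the second derivatives of \<open>w\<close> are obtained.\<close>

lemma power_series2_has_derivative:
  fixes c :: "nat \<Rightarrow> nat \<Rightarrow> 'b::banach"
  assumes f: "power_series2 c r f"
  shows "\<exists>f1 f2. power_series2 (\<lambda>i j. real (Suc i) *\<^sub>R c (Suc i) j) r f1 \<and>
    power_series2 (\<lambda>i j. real (Suc j) *\<^sub>R c i (Suc j)) r f2 \<and>
    (\<forall>x v. \<bar>x\<bar> < r \<and> \<bar>v\<bar> < r \<longrightarrow>
       (f has_derivative (\<lambda>(h, k). h *\<^sub>R f1 (x, v) + k *\<^sub>R f2 (x, v))) (at (x, v)))"
proof -
  \<comment> \<open>The formally differentiated terms; the factors \<open>real i\<close> and \<open>real j\<close> vanish where the truncated exponents
    \<open>i - 1\<close> and \<open>j - 1\<close> are off.\<close>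
  define T1 where "T1 = (\<lambda>(x :: real, v :: real) (i, j). (real i * x ^ (i - 1) * v ^ j) *\<^sub>R c i j)"
  define T2 where "T2 = (\<lambda>(x :: real, v :: real) (i, j). (real j * x ^ i * v ^ (j - 1)) *\<^sub>R c i j)"
  define f1 where "f1 z = infsum (T1 z) UNIV" for z
  define f2 where "f2 z = infsum (T2 z) UNIV" for z
  define m where "m \<rho> = (\<lambda>(i, j). real (Suc (i + j)) * \<rho> ^ (i + j) * norm (c i j))" for \<rho>
  have m: "m \<rho> summable_on UNIV" if "0 < \<rho>" "\<rho> < r" for \<rho>
    unfolding m_def by (rule power_series2_majorant[OF f that])
  \<comment> \<open>Valid for \<open>i = 0\<close> too, since both sides are then zero.\<close>
  have pow: "real i * t ^ (i - 1) = real i * t ^ i / t" if "t > 0" for i and t :: real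
    using that by (cases i) auto
  have le1: "norm (T1 (x, v) p) \<le> m \<rho> p / \<rho>" if "0 < \<rho>" "\<bar>x\<bar> \<le> \<rho>" "\<bar>v\<bar> \<le> \<rho>" for x v \<rho> p
  proof -
    obtain i j where p: "p = (i, j)" by force
    have "real i * \<bar>x\<bar> ^ (i - 1) * \<bar>v\<bar> ^ j \<le> real i * \<rho> ^ (i - 1) * \<rho> ^ j"
      using that by (intro mult_mono power_mono) auto
    also have "\<dots> = real i * \<rho> ^ (i + j) / \<rho>"
      using pow[OF that(1), of i] by (simp add: power_add)
    also have "\<dots> \<le> real (Suc (i + j)) * \<rho> ^ (i + j) / \<rho>"
      using that(1) by (intro divide_right_mono mult_right_mono) auto
    finally have "real i * \<bar>x\<bar> ^ (i - 1) * \<bar>v\<bar> ^ j * norm (c i j)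
        \<le> real (Suc (i + j)) * \<rho> ^ (i + j) / \<rho> * norm (c i j)"
      by (rule mult_right_mono) simp
    then show ?thesis
      by (simp add: p T1_def m_def abs_mult power_abs)
  qed
  have le2: "norm (T2 (x, v) p) \<le> m \<rho> p / \<rho>" if "0 < \<rho>" "\<bar>x\<bar> \<le> \<rho>" "\<bar>v\<bar> \<le> \<rho>" for x v \<rho> p
  proof -
    obtain i j where p: "p = (i, j)" by force
    have "real j * \<bar>x\<bar> ^ i * \<bar>v\<bar> ^ (j - 1) \<le> real j * \<rho> ^ i * \<rho> ^ (j - 1)"
      using that by (intro mult_mono power_mono) auto
    also have "\<dots> = \<rho> ^ i * (real j * \<rho> ^ (j - 1))"
      by simp
    also have "\<dots> = real j * \<rho> ^ (i + j) / \<rho>"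
      unfolding pow[OF that(1), of j] by (simp add: power_add)
    also have "\<dots> \<le> real (Suc (i + j)) * \<rho> ^ (i + j) / \<rho>"
      using that(1) by (intro divide_right_mono mult_right_mono) auto
    finally have "real j * \<bar>x\<bar> ^ i * \<bar>v\<bar> ^ (j - 1) * norm (c i j)
        \<le> real (Suc (i + j)) * \<rho> ^ (i + j) / \<rho> * norm (c i j)"
      by (rule mult_right_mono) simp
    then show ?thesis
      by (simp add: p T2_def m_def abs_mult power_abs)
  qed
  have between: "\<exists>\<rho>>0. \<rho> < r \<and> \<bar>x\<bar> < \<rho> \<and> \<bar>v\<bar> < \<rho>" if "\<bar>x\<bar> < r" "\<bar>v\<bar> < r" for x v :: real
    using that by (intro exI[of _ "(max \<bar>x\<bar> \<bar>v\<bar> + r) / 2"]) (auto simp: max_def)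
  have sum1: "(T1 (x, v) has_sum f1 (x, v)) UNIV" and sum2: "(T2 (x, v) has_sum f2 (x, v)) UNIV"
    if xv: "\<bar>x\<bar> < r" "\<bar>v\<bar> < r" for x v
  proof -
    obtain \<rho> where \<rho>: "\<rho> > 0" "\<rho> < r" "\<bar>x\<bar> < \<rho>" "\<bar>v\<bar> < \<rho>" using between[OF xv] by blast
    have s: "(\<lambda>p. m \<rho> p / \<rho>) summable_on UNIV"
      using summable_on_cmult_left[OF m[OF \<rho>(1,2)], of "1 / \<rho>"] by simp
    have "(\<lambda>p. norm (T1 (x, v) p)) summable_on UNIV" "(\<lambda>p. norm (T2 (x, v) p)) summable_on UNIV"
      using le1[of \<rho> x v] le2[of \<rho> x v] \<rho> by (auto intro!: summable_on_comparison_test[OF s])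
    then show "(T1 (x, v) has_sum f1 (x, v)) UNIV" "(T2 (x, v) has_sum f2 (x, v)) UNIV"
      by (auto simp: f1_def f2_def intro!: has_sum_infsum abs_summable_summable)
  qed
  have "power_series2 (\<lambda>i j. real (Suc i) *\<^sub>R c (Suc i) j) r f1"
    unfolding power_series2_def
  proof (intro allI impI)
    fix x v :: real assume xv: "\<bar>x\<bar> < r \<and> \<bar>v\<bar> < r"
    have "(T1 (x, v) has_sum f1 (x, v)) (range (\<lambda>(i, j). (Suc i, j)))"
    proof (rule iffD1[OF has_sum_cong_neutral])
      show "(T1 (x, v) has_sum f1 (x, v)) UNIV" using sum1 xv by blast
      show "T1 (x, v) p = 0" if "p \<in> UNIV - range (\<lambda>(i, j). (Suc i, j))" for p
      proof (cases p)
        case (Pair i j)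
        with that have "i = 0" by (cases i) (auto simp: image_iff)
        then show ?thesis by (simp add: Pair T1_def)
      qed
    qed auto
    then have "(T1 (x, v) \<circ> (\<lambda>(i, j). (Suc i, j)) has_sum f1 (x, v)) UNIV"
      by (subst (asm) has_sum_reindex) (auto simp: inj_on_def)
    moreover have "T1 (x, v) \<circ> (\<lambda>(i, j). (Suc i, j)) =
        (\<lambda>(i, j). (x ^ i * v ^ j) *\<^sub>R real (Suc i) *\<^sub>R c (Suc i) j)"
      by (auto simp: T1_def fun_eq_iff mult_ac)
    ultimately show "((\<lambda>(i, j). (x ^ i * v ^ j) *\<^sub>R real (Suc i) *\<^sub>R c (Suc i) j) has_sum f1 (x, v)) UNIV"
      by simp
  qed
  moreover have "power_series2 (\<lambda>i j. real (Suc j) *\<^sub>R c i (Suc j)) r f2"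
    unfolding power_series2_def
  proof (intro allI impI)
    fix x v :: real assume xv: "\<bar>x\<bar> < r \<and> \<bar>v\<bar> < r"
    have "(T2 (x, v) has_sum f2 (x, v)) (range (\<lambda>(i, j). (i, Suc j)))"
    proof (rule iffD1[OF has_sum_cong_neutral])
      show "(T2 (x, v) has_sum f2 (x, v)) UNIV" using sum2 xv by blast
      show "T2 (x, v) p = 0" if "p \<in> UNIV - range (\<lambda>(i, j). (i, Suc j))" for p
      proof (cases p)
        case (Pair i j)
        with that have "j = 0" by (cases j) (auto simp: image_iff)
        then show ?thesis by (simp add: Pair T2_def)
      qed
    qed auto
    then have "(T2 (x, v) \<circ> (\<lambda>(i, j). (i, Suc j)) has_sum f2 (x, v)) UNIV"
      by (subst (asm) has_sum_reindex) (auto simp: inj_on_def)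
    moreover have "T2 (x, v) \<circ> (\<lambda>(i, j). (i, Suc j)) =
        (\<lambda>(i, j). (x ^ i * v ^ j) *\<^sub>R real (Suc j) *\<^sub>R c i (Suc j))"
      by (auto simp: T2_def fun_eq_iff mult_ac)
    ultimately show "((\<lambda>(i, j). (x ^ i * v ^ j) *\<^sub>R real (Suc j) *\<^sub>R c i (Suc j)) has_sum f2 (x, v)) UNIV"
      by simp
  qed
  moreover have "(f has_derivative (\<lambda>(h, k). h *\<^sub>R f1 (x, v) + k *\<^sub>R f2 (x, v))) (at (x, v))"
    if xv: "\<bar>x\<bar> < r" "\<bar>v\<bar> < r" for x v
  proof -
    obtain \<rho> where \<rho>: "\<rho> > 0" "\<rho> < r" "\<bar>x\<bar> < \<rho>" "\<bar>v\<bar> < \<rho>" using between[OF xv] by blast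
    define S where "S = {-\<rho><..<\<rho>} \<times> {-\<rho><..<\<rho>}"
    have S: "\<bar>fst z\<bar> < \<rho> \<and> \<bar>snd z\<bar> < \<rho>" if "z \<in> S" for z
      using that by (auto simp: S_def)
    have "(f has_derivative (\<lambda>h. fst h *\<^sub>R f1 (x, v) + snd h *\<^sub>R f2 (x, v))) (at (x, v))"
    proof (rule has_derivative_series_majorized[where S = S
        and f = "\<lambda>n z. case prod_decode n of (i, j) \<Rightarrow> (fst z ^ i * snd z ^ j) *\<^sub>R c i j"
        and f' = "\<lambda>n z h. fst h *\<^sub>R T1 z (prod_decode n) + snd h *\<^sub>R T2 z (prod_decode n)"
        and g' = "\<lambda>z h. fst h *\<^sub>R f1 z + snd h *\<^sub>R f2 z"
        and M = "\<lambda>n. 2 / \<rho> * m \<rho> (prod_decode n)"])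
      show "open S" "convex S" by (auto simp: S_def open_Times convex_Times)
      show "(x, v) \<in> S" using \<rho> by (auto simp: S_def)
      show "summable (\<lambda>n. 2 / \<rho> * m \<rho> (prod_decode n))"
        using has_sum_prod_decode_sums[OF has_sum_infsum[OF m[OF \<rho>(1,2)]]]
        by (intro summable_mult sums_summable)
      show "((\<lambda>z. case prod_decode n of (i, j) \<Rightarrow> (fst z ^ i * snd z ^ j) *\<^sub>R c i j) has_derivative
          (\<lambda>h. fst h *\<^sub>R T1 z (prod_decode n) + snd h *\<^sub>R T2 z (prod_decode n))) (at z)" for n z
        by (cases "prod_decode n"; cases z)
          (auto simp: T1_def T2_def scaleR_left_distrib mult_ac intro!: derivative_eq_intros)
      show "norm (fst h *\<^sub>R T1 z (prod_decode n) + snd h *\<^sub>R T2 z (prod_decode n))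
          \<le> 2 / \<rho> * m \<rho> (prod_decode n) * norm h" if "z \<in> S" for n z h
      proof -
        have "norm (fst h *\<^sub>R T1 z (prod_decode n)) \<le> norm h * (m \<rho> (prod_decode n) / \<rho>)"
          using le1[of \<rho> "fst z" "snd z" "prod_decode n"] S[OF that] \<rho>(1) norm_fst_le[of "fst h" "snd h"]
          unfolding norm_scaleR by (intro mult_mono) auto
        moreover have "norm (snd h *\<^sub>R T2 z (prod_decode n)) \<le> norm h * (m \<rho> (prod_decode n) / \<rho>)"
          using le2[of \<rho> "fst z" "snd z" "prod_decode n"] S[OF that] \<rho>(1) norm_snd_le[of "snd h" "fst h"]
          unfolding norm_scaleR by (intro mult_mono) auto
        moreover have "norm h * (m \<rho> (prod_decode n) / \<rho>) + norm h * (m \<rho> (prod_decode n) / \<rho>)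
            = 2 / \<rho> * m \<rho> (prod_decode n) * norm h"
          by simp
        ultimately show ?thesis
          using norm_triangle_ineq[of "fst h *\<^sub>R T1 z (prod_decode n)" "snd h *\<^sub>R T2 z (prod_decode n)"]
          by linarith
      qed
      show "(\<lambda>n. fst h *\<^sub>R T1 z (prod_decode n) + snd h *\<^sub>R T2 z (prod_decode n)) sums
          (fst h *\<^sub>R f1 z + snd h *\<^sub>R f2 z)" if "z \<in> S" for z h
        using S[OF that] \<rho>(2) sum1[of "fst z" "snd z"] sum2[of "fst z" "snd z"]
        by (intro sums_add sums_scaleR_right has_sum_prod_decode_sums) auto
      show "(\<lambda>n. case prod_decode n of (i, j) \<Rightarrow> (fst z ^ i * snd z ^ j) *\<^sub>R c i j) sums f z"
        if "z \<in> S" for z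
        using S[OF that] \<rho>(2) f by (intro has_sum_prod_decode_sums) (cases z, auto simp: power_series2_def)
    qed
    then show ?thesis by (simp add: case_prod_unfold)
  qed
  ultimately show ?thesis by blast
qed

text \<open>Only the two coefficients that enter the reduced model are needed. Iterated \<open>deriv\<close> depends on the
  values of the inner derivative near \<open>0\<close> only, where it is one of the partial derivatives above.\<close>

lemma taylor_coeff_power_series2:
  fixes c :: "nat \<Rightarrow> nat \<Rightarrow> real ^ 'n"
  assumes f: "power_series2 c r f" and r: "0 < r"
  shows "taylor_coeff f 2 0 = c 2 0" "taylor_coeff f 0 2 = c 0 2"
proof -
  obtain f1 f2 where f1: "power_series2 (\<lambda>i j. real (Suc i) *\<^sub>R c (Suc i) j) r f1"
    and f2: "power_series2 (\<lambda>i j. real (Suc j) *\<^sub>R c i (Suc j)) r f2"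
    and f': "\<And>x v. \<bar>x\<bar> < r \<Longrightarrow> \<bar>v\<bar> < r \<Longrightarrow>
       (f has_derivative (\<lambda>(h, k). h *\<^sub>R f1 (x, v) + k *\<^sub>R f2 (x, v))) (at (x, v))"
    using power_series2_has_derivative[OF f] by blast
  obtain f11 f12 where f11: "power_series2 (\<lambda>i j. real (Suc i) *\<^sub>R real (Suc (Suc i)) *\<^sub>R c (Suc (Suc i)) j) r f11"
    and f1': "\<And>x v. \<bar>x\<bar> < r \<Longrightarrow> \<bar>v\<bar> < r \<Longrightarrow>
       (f1 has_derivative (\<lambda>(h, k). h *\<^sub>R f11 (x, v) + k *\<^sub>R f12 (x, v))) (at (x, v))"
    using power_series2_has_derivative[OF f1] by blast
  obtain f21 f22 where f22: "power_series2 (\<lambda>i j. real (Suc j) *\<^sub>R real (Suc (Suc j)) *\<^sub>R c i (Suc (Suc j))) r f22"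
    and f2': "\<And>x v. \<bar>x\<bar> < r \<Longrightarrow> \<bar>v\<bar> < r \<Longrightarrow>
       (f2 has_derivative (\<lambda>(h, k). h *\<^sub>R f21 (x, v) + k *\<^sub>R f22 (x, v))) (at (x, v))"
    using power_series2_has_derivative[OF f2] by blast
  have partial1: "((\<lambda>x. g (x, 0) $ m) has_field_derivative g1 (x, 0) $ m) (at x)"
    if "(g has_derivative (\<lambda>(h, k). h *\<^sub>R g1 (x, 0) + k *\<^sub>R g2 (x, 0))) (at (x, 0))"
    for g g1 g2 :: "real \<times> real \<Rightarrow> real ^ 'n" and x m
  proof -
    have "((\<lambda>x. (x, 0)) has_derivative (\<lambda>h. (h, 0 :: real))) (at x)"
      by (auto intro!: derivative_eq_intros)
    from has_derivative_compose[OF this that]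
    have "((\<lambda>x. g (x, 0)) has_derivative (\<lambda>h. h *\<^sub>R g1 (x, 0))) (at x)" by simp
    from bounded_linear.has_derivative[OF bounded_linear_vec_nth this, of m]
    show ?thesis by (simp add: has_field_derivative_def mult.commute[of _ "g1 _ $ _"])
  qed
  have partial2: "((\<lambda>v. g (0, v) $ m) has_field_derivative g2 (0, v) $ m) (at v)"
    if "(g has_derivative (\<lambda>(h, k). h *\<^sub>R g1 (0, v) + k *\<^sub>R g2 (0, v))) (at (0, v))"
    for g g1 g2 :: "real \<times> real \<Rightarrow> real ^ 'n" and v m
  proof -
    have "((\<lambda>v. (0, v)) has_derivative (\<lambda>h. (0 :: real, h))) (at v)"
      by (auto intro!: derivative_eq_intros)
    from has_derivative_compose[OF this that]
    have "((\<lambda>v. g (0, v)) has_derivative (\<lambda>h. h *\<^sub>R g2 (0, v))) (at v)" by simp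
    from bounded_linear.has_derivative[OF bounded_linear_vec_nth this, of m]
    show ?thesis by (simp add: has_field_derivative_def mult.commute[of _ "g2 _ $ _"])
  qed
  have near: "eventually (\<lambda>x. \<bar>x\<bar> < r) (nhds (0 :: real))"
    using r by (auto simp: eventually_nhds_metric dist_norm)
  have "deriv (deriv (\<lambda>x. f (x, 0) $ m)) 0 = 2 * c 2 0 $ m" for m
  proof -
    have "eventually (\<lambda>x. deriv (\<lambda>x. f (x, 0) $ m) x = f1 (x, 0) $ m) (nhds 0)"
      using near by eventually_elim (rule DERIV_imp_deriv[OF partial1[where g = f and ?g1.0 = f1 and ?g2.0 = f2, OF f']], use r in auto)
    then have "deriv (deriv (\<lambda>x. f (x, 0) $ m)) 0 = deriv (\<lambda>x. f1 (x, 0) $ m) 0"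
      by (rule deriv_cong_ev) simp
    also have "\<dots> = f11 (0, 0) $ m"
      by (rule DERIV_imp_deriv[OF partial1[where g = f1 and ?g1.0 = f11 and ?g2.0 = f12, OF f1']]) (use r in auto)
    finally show ?thesis
      using power_series2_at_0[OF f11 r] by (simp add: numeral_2_eq_2)
  qed
  then show "taylor_coeff f 2 0 = c 2 0"
    by (simp add: taylor_coeff_def vec_eq_iff numeral_2_eq_2)
  have "deriv (deriv (\<lambda>v. f (0, v) $ m)) 0 = 2 * c 0 2 $ m" for m
  proof -
    have "eventually (\<lambda>v. deriv (\<lambda>v. f (0, v) $ m) v = f2 (0, v) $ m) (nhds 0)"
      using near by eventually_elim (rule DERIV_imp_deriv[OF partial2[where g = f and ?g1.0 = f1 and ?g2.0 = f2, OF f']], use r in auto)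
    then have "deriv (deriv (\<lambda>v. f (0, v) $ m)) 0 = deriv (\<lambda>v. f2 (0, v) $ m) 0"
      by (rule deriv_cong_ev) simp
    also have "\<dots> = f22 (0, 0) $ m"
      by (rule DERIV_imp_deriv[OF partial2[where g = f2 and ?g1.0 = f21 and ?g2.0 = f22, OF f2']]) (use r in auto)
    finally show ?thesis
      using power_series2_at_0[OF f22 r] by (simp add: numeral_2_eq_2)
  qed
  then show "taylor_coeff f 0 2 = c 0 2"
    by (simp add: taylor_coeff_def vec_eq_iff numeral_2_eq_2)
qed

text \<open>Removing the finitely many terms of degree at most 2 leaves a double power series with
  coefficients vanishing below order 3.\<close>

lemma power_series2_quadratic_part:
  fixes c :: "nat \<Rightarrow> nat \<Rightarrow> 'b::banach"
  assumes f: "power_series2 c r f" and r: "0 < r"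
    and low: "c 0 0 = 0" "c 1 0 = 0" "c 0 1 = 0"
  shows "\<exists>C \<delta>. \<delta> > 0 \<and> (\<forall>x v. norm (x, v) < \<delta> \<longrightarrow>
     norm (f (x, v) - (x\<^sup>2 *\<^sub>R c 2 0 + (x * v) *\<^sub>R c 1 1 + v\<^sup>2 *\<^sub>R c 0 2)) \<le> C * norm (x, v) ^ 3)"
proof -
  define c' where "c' i j = (if i + j < 3 then 0 else c i j)" for i j
  have "power_series2 c' r (\<lambda>(x, v). f (x, v) - (x\<^sup>2 *\<^sub>R c 2 0 + (x * v) *\<^sub>R c 1 1 + v\<^sup>2 *\<^sub>R c 0 2))"
    unfolding power_series2_def
  proof (intro allI impI)
    fix x v :: real assume xv: "\<bar>x\<bar> < r \<and> \<bar>v\<bar> < r"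
    let ?F = "{(0, 0), (1, 0), (0, 1), (2, 0), (1, 1), (0, 2)} :: (nat \<times> nat) set"
    have "((\<lambda>(i, j). (x ^ i * v ^ j) *\<^sub>R c i j) has_sum
        f (x, v) - sum (\<lambda>(i, j). (x ^ i * v ^ j) *\<^sub>R c i j) ?F) (UNIV - ?F)"
      using f xv by (intro has_sum_Diff has_sum_finite) (auto simp: power_series2_def)
    also have "sum (\<lambda>(i, j). (x ^ i * v ^ j) *\<^sub>R c i j) ?F =
        x\<^sup>2 *\<^sub>R c 2 0 + (x * v) *\<^sub>R c 1 1 + v\<^sup>2 *\<^sub>R c 0 2"
      using low by (simp add: add.assoc)
    also have "((\<lambda>(i, j). (x ^ i * v ^ j) *\<^sub>R c i j) has_sum s) (UNIV - ?F) \<longleftrightarrow>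
        ((\<lambda>(i, j). (x ^ i * v ^ j) *\<^sub>R c' i j) has_sum s) UNIV" for s
    proof (rule has_sum_cong_neutral)
      fix p :: "nat \<times> nat" assume "p \<in> UNIV - (UNIV - ?F)"
      then show "(case p of (i, j) \<Rightarrow> (x ^ i * v ^ j) *\<^sub>R c' i j) = 0" by (auto simp: c'_def)
    next
      fix p assume p: "p \<in> (UNIV - ?F) \<inter> UNIV"
      obtain i j where ij: "p = (i, j)" by force
      have "\<not> i + j < 3"
      proof
        assume "i + j < 3"
        then have "i \<in> {0, 1, 2}" "j \<in> {0, 1, 2}" "i + j < 3" by auto
        with p ij show False by auto
      qed
      then show "(case p of (i, j) \<Rightarrow> (x ^ i * v ^ j) *\<^sub>R c i j) = (case p of (i, j) \<Rightarrow> (x ^ i * v ^ j) *\<^sub>R c' i j)"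
        by (simp add: ij c'_def)
    qed auto
    finally show "((\<lambda>(i, j). (x ^ i * v ^ j) *\<^sub>R c' i j) has_sum
        (case (x, v) of (x, v) \<Rightarrow> f (x, v) - (x\<^sup>2 *\<^sub>R c 2 0 + (x * v) *\<^sub>R c 1 1 + v\<^sup>2 *\<^sub>R c 0 2))) UNIV"
      by simp
  qed
  from power_series2_order[OF this r, of 3] show ?thesis
    by (auto simp: c'_def)
qed

section \<open>Polynomials near a graph tangent to the first axis\<close>

lemma finite_mdeg_le: "finite {(j :: nat, k :: 'n::finite \<Rightarrow> nat). j + mdeg k \<le> l}"
proof (rule finite_subset)
  show "{(j :: nat, k :: 'n \<Rightarrow> nat). j + mdeg k \<le> l} \<subseteq> {..l} \<times> (UNIV \<rightarrow>\<^sub>E {..l})"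
  proof clarify
    fix j and k :: "'n \<Rightarrow> nat" assume "j + mdeg k \<le> l"
    moreover have "k i \<le> mdeg k" for i
      unfolding mdeg_def by (rule member_le_sum) auto
    ultimately have "j \<le> l" "\<And>i. k i \<le> l"
      using le_trans add_leD1 add_leD2 by blast+
    then show "j \<in> {..l} \<and> k \<in> UNIV \<rightarrow>\<^sub>E {..l}"
      by (simp add: PiE_UNIV_domain)
  qed
  show "finite ({..l} \<times> ((UNIV :: 'n set) \<rightarrow>\<^sub>E {..l}))"
    by (intro finite_cartesian_product finite_PiE) auto
qed

lemma mdeg_eq_0_iff: "mdeg k = 0 \<longleftrightarrow> k = (\<lambda>_. 0)"
  by (auto simp: mdeg_def)

lemma mdeg_zero [simp]: "mdeg (\<lambda>_. 0) = 0"
  by (simp add: mdeg_def)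

lemma mdeg_unit_index: "mdeg (unit_index i) = 1"
  by (simp add: mdeg_def unit_index_def)

lemma mdeg_eq_1_iff: "mdeg k = 1 \<longleftrightarrow> k \<in> range unit_index"
proof
  assume k: "mdeg k = 1"
  then obtain i where i: "k i \<noteq> 0"
    by (force simp: mdeg_def)
  have "mdeg k = k i + (\<Sum>i'\<in>UNIV - {i}. k i')"
    unfolding mdeg_def by (simp add: sum.remove)
  with k i have "k i = 1" and rest: "(\<Sum>i'\<in>UNIV - {i}. k i') = 0" by linarith+
  moreover have "k i' = 0" if "i' \<noteq> i" for i'
    using rest that by (simp add: sum_eq_0_iff)
  ultimately have "k = unit_index i" by (auto simp: unit_index_def)
  then show "k \<in> range unit_index" by simp
qed (auto simp: mdeg_unit_index)

lemma inj_unit_index: "inj unit_index"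
proof (rule injI)
  fix i j :: "'n::finite" assume "unit_index i = unit_index j"
  then have "unit_index i i = unit_index j i" by simp
  then show "i = j" by (simp add: unit_index_def split: if_splits)
qed

lemma abs_prod_nth_power_le: "\<bar>\<Prod>i\<in>UNIV. (y $ i) ^ k i\<bar> \<le> norm y ^ mdeg k"
  for y :: "real ^ 'n"
proof -
  have "\<bar>\<Prod>i\<in>UNIV. (y $ i) ^ k i\<bar> = (\<Prod>i\<in>UNIV. \<bar>y $ i\<bar> ^ k i)"
    by (simp add: abs_prod power_abs)
  also have "\<dots> \<le> (\<Prod>i\<in>UNIV. norm y ^ k i)"
    by (intro prod_mono conjI power_mono component_le_norm_cart) auto
  also have "\<dots> = norm y ^ mdeg k"
    by (simp add: mdeg_def power_sum)
  finally show ?thesis .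
qed

text \<open>On a graph tangent to \<open>y = 0\<close> the vector \<open>y\<close> is of second order, so \<open>x\<close> has weight 1 and \<open>y\<close> has weight 2:
  the monomial with indices \<open>j\<close> and \<open>k\<close> is of order \<open>j + 2 * mdeg k\<close>. Among the monomials of degree 2 or 3 the
  only ones of weight below 4 are \<open>x\<^sup>2\<close>, \<open>x ^ 3\<close> and \<open>x * y $ i\<close>.\<close>

lemma poly_xy_weighted_expansion:
  fixes c :: "nat \<Rightarrow> ('n::finite \<Rightarrow> nat) \<Rightarrow> 'b::real_normed_vector"
  assumes l: "l \<le> 3" and high: "\<And>j k. j + mdeg k > l \<Longrightarrow> c j k = 0" and B: "B \<ge> 1"
  shows "\<exists>C. \<forall>x y t. \<bar>x\<bar> \<le> t \<longrightarrow> norm y \<le> B * t\<^sup>2 \<longrightarrow> t \<le> 1 \<longrightarrow>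
    norm (poly_xy l c x y - (x\<^sup>2 *\<^sub>R c 2 (\<lambda>_. 0) + x ^ 3 *\<^sub>R c 3 (\<lambda>_. 0)
       + (\<Sum>i\<in>UNIV. (x * y $ i) *\<^sub>R c 1 (unit_index i)))) \<le> C * t ^ 4"
proof -
  let ?mono = "\<lambda>x y (j, k). (x ^ j * (\<Prod>i\<in>UNIV. (y $ i) ^ k i)) *\<^sub>R c j k"
  let ?I = "{(j, k). 2 \<le> j + mdeg k \<and> j + mdeg k \<le> 3} :: (nat \<times> ('n \<Rightarrow> nat)) set"
  let ?low = "insert (2, \<lambda>_. 0) (insert (3, \<lambda>_. 0) ((\<lambda>i. (1, unit_index i)) ` UNIV)) :: (nat \<times> ('n \<Rightarrow> nat)) set"
  have fin: "finite ?I"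
    by (rule finite_subset[OF _ finite_mdeg_le[of 3]]) auto
  have low: "?low \<subseteq> ?I"
    by (auto simp: mdeg_eq_0_iff[THEN iffD2] mdeg_unit_index simp del: One_nat_def)
  have high': "j + mdeg k \<le> l" if "c j k \<noteq> 0" for j k
    using high[of j k] that by (cases "l < j + mdeg k") auto
  \<comment> \<open>Whether \<open>l\<close> is 2 or 3, the sum may be extended to degree 3 by zero coefficients.\<close>
  have poly: "poly_xy l c x y = sum (?mono x y) ?I" for x y
    unfolding poly_xy_def
    by (rule sum.mono_neutral_left[OF fin]) (use l in \<open>auto dest: high'\<close>)
  have lowsum: "sum (?mono x y) ?low = x\<^sup>2 *\<^sub>R c 2 (\<lambda>_. 0) + x ^ 3 *\<^sub>R c 3 (\<lambda>_. 0)
       + (\<Sum>i\<in>UNIV. (x * y $ i) *\<^sub>R c 1 (unit_index i))" for x and y :: "real ^ 'n"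
  proof -
    have u: "(\<Prod>i'\<in>UNIV. (y $ i') ^ unit_index i i') = y $ i" for i
    proof -
      have "(\<Prod>i'\<in>UNIV. (y $ i') ^ unit_index i i') = (\<Prod>i'\<in>UNIV. if i' = i then y $ i' else 1)"
        by (rule prod.cong) (auto simp: unit_index_def)
      then show ?thesis by simp
    qed
    have "sum (?mono x y) ((\<lambda>i. (1, unit_index i)) ` UNIV) = (\<Sum>i\<in>UNIV. (x * y $ i) *\<^sub>R c 1 (unit_index i))"
      by (subst sum.reindex) (auto simp: inj_on_def u dest: injD[OF inj_unit_index])
    moreover have "(2 :: nat, \<lambda>_ :: 'n. 0 :: nat) \<notin> insert (3, \<lambda>_. 0) ((\<lambda>i. (1, unit_index i)) ` UNIV)"
      and "(3 :: nat, \<lambda>_ :: 'n. 0 :: nat) \<notin> (\<lambda>i. (1, unit_index i)) ` UNIV" by auto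
    ultimately show ?thesis by (simp add: add.assoc)
  qed
  have rest: "norm (?mono x y p) \<le> B ^ mdeg (snd p) * norm (c (fst p) (snd p)) * t ^ 4"
    if p: "p \<in> ?I - ?low" and x: "\<bar>x\<bar> \<le> t" and y: "norm y \<le> B * t\<^sup>2" and t: "t \<le> 1" for p x t and y :: "real ^ 'n"
  proof -
    obtain j k where jk: "p = (j, k)" by force
    \<comment> \<open>Weight at most 3 forces \<open>mdeg k \<le> 1\<close>, and then \<open>p\<close> belongs to \<open>?low\<close>.\<close>
    have "j + 2 * mdeg k \<ge> 4"
    proof (rule ccontr)
      assume "\<not> 4 \<le> j + 2 * mdeg k"
      then have "mdeg k = 0 \<or> mdeg k = 1" and "j + 2 * mdeg k \<le> 3" by auto
      then show False
        using p unfolding jk mdeg_eq_1_iff by (auto simp: mdeg_unit_index mdeg_eq_0_iff)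
    qed
    have t0: "0 \<le> t" using x by simp
    have "\<bar>x ^ j * (\<Prod>i\<in>UNIV. (y $ i) ^ k i)\<bar> \<le> t ^ j * (B * t\<^sup>2) ^ mdeg k"
      unfolding abs_mult power_abs using x y t0
      by (intro mult_mono power_mono order_trans[OF abs_prod_nth_power_le]) auto
    also have "\<dots> = B ^ mdeg k * t ^ (j + 2 * mdeg k)"
      by (simp add: power_mult_distrib power_add power_mult)
    also have "\<dots> \<le> B ^ mdeg k * t ^ 4"
      using B t t0 \<open>j + 2 * mdeg k \<ge> 4\<close> by (intro mult_left_mono power_decreasing) auto
    finally have "\<bar>x ^ j * (\<Prod>i\<in>UNIV. (y $ i) ^ k i)\<bar> * norm (c j k) \<le> B ^ mdeg k * t ^ 4 * norm (c j k)"
      by (rule mult_right_mono) simp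
    then show ?thesis by (simp add: jk mult_ac)
  qed
  show ?thesis
  proof (intro exI allI impI)
    fix x t :: real and y :: "real ^ 'n" assume *: "\<bar>x\<bar> \<le> t" "norm y \<le> B * t\<^sup>2" "t \<le> 1"
    have diff: "poly_xy l c x y - sum (?mono x y) ?low = sum (?mono x y) (?I - ?low)"
      unfolding poly by (rule sum_diff[OF fin low, symmetric])
    have "norm (poly_xy l c x y - sum (?mono x y) ?low) \<le> (\<Sum>p\<in>?I - ?low. B ^ mdeg (snd p) * norm (c (fst p) (snd p)) * t ^ 4)"
      unfolding diff by (rule sum_norm_le) (rule rest[OF _ *])
    also have "\<dots> = (\<Sum>p\<in>?I - ?low. B ^ mdeg (snd p) * norm (c (fst p) (snd p))) * t ^ 4"
      by (simp add: sum_distrib_right)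
    finally show "norm (poly_xy l c x y - (x\<^sup>2 *\<^sub>R c 2 (\<lambda>_. 0) + x ^ 3 *\<^sub>R c 3 (\<lambda>_. 0)
       + (\<Sum>i\<in>UNIV. (x * y $ i) *\<^sub>R c 1 (unit_index i))))
       \<le> (\<Sum>p\<in>?I - ?low. B ^ mdeg (snd p) * norm (c (fst p) (snd p))) * t ^ 4"
      unfolding lowsum .
  qed
qed

text \<open>A bound on the derivative is part of the definition because that is what is used in the end: along
  a trajectory near the origin, the time derivative of \<open>P\<close> is small of second order. The unit ball is just a
  convenient neighbourhood on which higher order implies lower order. For \<open>m = 0\<close> the truncated exponent
  \<open>m - 1\<close> gives a merely bounded derivative.\<close>

definition vanishes_to_order :: "nat \<Rightarrow> ('a::real_normed_vector \<Rightarrow> real) \<Rightarrow> bool" where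
  "vanishes_to_order m f \<longleftrightarrow> (\<exists>C f'. \<forall>z. norm z \<le> 1 \<longrightarrow>
     (f has_derivative f' z) (at z) \<and> \<bar>f z\<bar> \<le> C * norm z ^ m \<and>
     (\<forall>h. \<bar>f' z h\<bar> \<le> C * norm z ^ (m - 1) * norm h))"

lemma vanishes_to_order_const: "vanishes_to_order 0 (\<lambda>_. a)"
  unfolding vanishes_to_order_def
  by (rule exI[of _ "\<bar>a\<bar>"], rule exI[of _ "\<lambda>_ _. 0"]) auto

lemma vanishes_to_order_linear:
  assumes "bounded_linear f"
  shows "vanishes_to_order 1 f"
proof -
  obtain K where "\<And>z. \<bar>f z\<bar> \<le> norm z * K"
    using bounded_linear.bounded[OF assms] by auto
  then show ?thesis
    unfolding vanishes_to_order_def using bounded_linear.has_derivative[OF assms has_derivative_ident]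
    by (intro exI[of _ K], intro exI[of _ "\<lambda>_. f"]) (auto simp: mult.commute)
qed

lemma vanishes_to_order_mult:
  assumes "vanishes_to_order m f" "vanishes_to_order n g"
  shows "vanishes_to_order (m + n) (\<lambda>z. f z * g z)"
proof -
  obtain C f' where f: "\<And>z. norm z \<le> 1 \<Longrightarrow> (f has_derivative f' z) (at z)"
    "\<And>z. norm z \<le> 1 \<Longrightarrow> \<bar>f z\<bar> \<le> C * norm z ^ m"
    "\<And>z h. norm z \<le> 1 \<Longrightarrow> \<bar>f' z h\<bar> \<le> C * norm z ^ (m - 1) * norm h"
    using assms(1) unfolding vanishes_to_order_def by blast
  obtain D g' where g: "\<And>z. norm z \<le> 1 \<Longrightarrow> (g has_derivative g' z) (at z)"
    "\<And>z. norm z \<le> 1 \<Longrightarrow> \<bar>g z\<bar> \<le> D * norm z ^ n"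
    "\<And>z h. norm z \<le> 1 \<Longrightarrow> \<bar>g' z h\<bar> \<le> D * norm z ^ (n - 1) * norm h"
    using assms(2) unfolding vanishes_to_order_def by blast
  define E where "E = \<bar>C\<bar> * \<bar>D\<bar>"
  show ?thesis
    unfolding vanishes_to_order_def
  proof (rule exI[of _ "2 * E"], rule exI[of _ "\<lambda>z h. f z * g' z h + f' z h * g z"],
      intro allI impI conjI)
    fix z :: 'a assume z: "norm z \<le> 1"
    note f = f[OF z] and g = g[OF z]
    have abs: "C * a \<le> \<bar>C\<bar> * a" "D * a \<le> \<bar>D\<bar> * a" if "0 \<le> a" for a :: real
      using that by (auto intro: mult_right_mono)
    have f0: "\<bar>f z\<bar> \<le> \<bar>C\<bar> * norm z ^ m" and g0: "\<bar>g z\<bar> \<le> \<bar>D\<bar> * norm z ^ n"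
      using f(2) g(2) abs(1)[of "norm z ^ m"] abs(2)[of "norm z ^ n"] by auto
    show "((\<lambda>z. f z * g z) has_derivative (\<lambda>h. f z * g' z h + f' z h * g z)) (at z)"
      by (rule has_derivative_mult[OF f(1) g(1)])
    have "\<bar>f z * g z\<bar> \<le> (\<bar>C\<bar> * norm z ^ m) * (\<bar>D\<bar> * norm z ^ n)"
      unfolding abs_mult using f0 g0 by (intro mult_mono) auto
    also have "\<dots> = E * norm z ^ (m + n)" by (simp add: E_def power_add mult_ac)
    also have "\<dots> \<le> 2 * E * norm z ^ (m + n)" by (simp add: E_def mult_right_mono)
    finally show "\<bar>f z * g z\<bar> \<le> 2 * E * norm z ^ (m + n)" .
    fix h
    have f1: "\<bar>f' z h\<bar> \<le> \<bar>C\<bar> * (norm z ^ (m - 1) * norm h)" and g1: "\<bar>g' z h\<bar> \<le> \<bar>D\<bar> * (norm z ^ (n - 1) * norm h)"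
      using f(3)[of h] g(3)[of h] abs(1)[of "norm z ^ (m - 1) * norm h"] abs(2)[of "norm z ^ (n - 1) * norm h"]
      by (auto simp: mult.assoc)
    have "\<bar>f z * g' z h\<bar> \<le> (\<bar>C\<bar> * norm z ^ m) * (\<bar>D\<bar> * (norm z ^ (n - 1) * norm h))"
      unfolding abs_mult using f0 g1 by (intro mult_mono) auto
    moreover have "\<bar>f' z h * g z\<bar> \<le> (\<bar>C\<bar> * (norm z ^ (m - 1) * norm h)) * (\<bar>D\<bar> * norm z ^ n)"
      unfolding abs_mult using f1 g0 by (intro mult_mono) auto
    ultimately have "\<bar>f z * g' z h + f' z h * g z\<bar> \<le>
        (\<bar>C\<bar> * norm z ^ m) * (\<bar>D\<bar> * (norm z ^ (n - 1) * norm h))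
        + (\<bar>C\<bar> * (norm z ^ (m - 1) * norm h)) * (\<bar>D\<bar> * norm z ^ n)"
      by linarith
    also have "\<dots> = E * norm h * norm z ^ (m + (n - 1)) + E * norm h * norm z ^ (m - 1 + n)"
      by (simp add: E_def power_add mult_ac)
    also have "\<dots> \<le> E * norm h * norm z ^ (m + n - 1) + E * norm h * norm z ^ (m + n - 1)"
      using z by (intro add_mono mult_left_mono power_decreasing) (auto simp: E_def)
    finally show "\<bar>f z * g' z h + f' z h * g z\<bar> \<le> 2 * E * norm z ^ (m + n - 1) * norm h"
      by (simp add: mult_ac)
  qed
qed

lemma vanishes_to_order_power:
  "vanishes_to_order m f \<Longrightarrow> vanishes_to_order (j * m) (\<lambda>z. f z ^ j)"
  by (induction j) (simp_all add: vanishes_to_order_const vanishes_to_order_mult)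

lemma vanishes_to_order_prod:
  assumes "finite I" "\<And>i. i \<in> I \<Longrightarrow> vanishes_to_order (m i) (f i)"
  shows "vanishes_to_order (\<Sum>i\<in>I. m i) (\<lambda>z. \<Prod>i\<in>I. f i z)"
  using assms by (induction I) (simp_all add: vanishes_to_order_const vanishes_to_order_mult)

lemma vanishes_to_order_mono:
  assumes "vanishes_to_order m f" "n \<le> m"
  shows "vanishes_to_order n f"
proof -
  obtain C f' where f: "\<And>z. norm z \<le> 1 \<Longrightarrow> (f has_derivative f' z) (at z)"
    "\<And>z. norm z \<le> 1 \<Longrightarrow> \<bar>f z\<bar> \<le> C * norm z ^ m"
    "\<And>z h. norm z \<le> 1 \<Longrightarrow> \<bar>f' z h\<bar> \<le> C * norm z ^ (m - 1) * norm h"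
    using assms(1) unfolding vanishes_to_order_def by blast
  have le: "C * norm z ^ a \<le> \<bar>C\<bar> * norm z ^ b" if "norm z \<le> 1" "b \<le> a" for a b and z :: 'a
    using that by (intro mult_mono power_decreasing) auto
  show ?thesis
    unfolding vanishes_to_order_def
  proof (rule exI[of _ "\<bar>C\<bar>"], rule exI[of _ f'], intro allI impI conjI)
    fix z :: 'a assume z: "norm z \<le> 1"
    show "(f has_derivative f' z) (at z)" by (rule f(1)[OF z])
    show "\<bar>f z\<bar> \<le> \<bar>C\<bar> * norm z ^ n"
      by (rule order_trans[OF f(2)[OF z] le[OF z assms(2)]])
    show "\<bar>f' z h\<bar> \<le> \<bar>C\<bar> * norm z ^ (n - 1) * norm h" for h
      using assms(2) z by (intro order_trans[OF f(3)[OF z]] mult_right_mono le) auto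
  qed
qed

lemma vanishes_to_order_add:
  assumes "vanishes_to_order m f" "vanishes_to_order m g"
  shows "vanishes_to_order m (\<lambda>z. f z + g z)"
proof -
  obtain C f' where f: "\<And>z. norm z \<le> 1 \<Longrightarrow> (f has_derivative f' z) (at z)"
    "\<And>z. norm z \<le> 1 \<Longrightarrow> \<bar>f z\<bar> \<le> C * norm z ^ m"
    "\<And>z h. norm z \<le> 1 \<Longrightarrow> \<bar>f' z h\<bar> \<le> C * norm z ^ (m - 1) * norm h"
    using assms(1) unfolding vanishes_to_order_def by blast
  obtain D g' where g: "\<And>z. norm z \<le> 1 \<Longrightarrow> (g has_derivative g' z) (at z)"
    "\<And>z. norm z \<le> 1 \<Longrightarrow> \<bar>g z\<bar> \<le> D * norm z ^ m"
    "\<And>z h. norm z \<le> 1 \<Longrightarrow> \<bar>g' z h\<bar> \<le> D * norm z ^ (m - 1) * norm h"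
    using assms(2) unfolding vanishes_to_order_def by blast
  show ?thesis
    unfolding vanishes_to_order_def
  proof (rule exI[of _ "C + D"], rule exI[of _ "\<lambda>z h. f' z h + g' z h"], intro allI impI conjI)
    fix z :: 'a assume z: "norm z \<le> 1"
    show "((\<lambda>z. f z + g z) has_derivative (\<lambda>h. f' z h + g' z h)) (at z)"
      by (rule has_derivative_add[OF f(1)[OF z] g(1)[OF z]])
    show "\<bar>f z + g z\<bar> \<le> (C + D) * norm z ^ m"
      using f(2)[OF z] g(2)[OF z] by (simp add: distrib_right)
    show "\<bar>f' z h + g' z h\<bar> \<le> (C + D) * norm z ^ (m - 1) * norm h" for h
      using f(3)[OF z, of h] g(3)[OF z, of h] by (simp add: distrib_right)
  qed
qed

lemma vanishes_to_order_sum: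
  assumes "finite I" "I \<noteq> {}" "\<And>i. i \<in> I \<Longrightarrow> vanishes_to_order m (f i)"
  shows "vanishes_to_order m (\<lambda>z. \<Sum>i\<in>I. f i z)"
  using assms by (induction I rule: finite_ne_induct) (simp_all add: vanishes_to_order_add)

lemma vanishes_to_order_poly_xy:
  fixes c :: "nat \<Rightarrow> ('n::finite \<Rightarrow> nat) \<Rightarrow> real"
  assumes l: "2 \<le> l"
  shows "vanishes_to_order 2 (\<lambda>(x, y). poly_xy l c x y)"
proof -
  let ?I = "{(j, k). 2 \<le> j + mdeg k \<and> j + mdeg k \<le> l} :: (nat \<times> ('n \<Rightarrow> nat)) set"
  have "finite ?I" by (rule finite_subset[OF _ finite_mdeg_le[of l]]) auto
  moreover have "(2, \<lambda>_. 0) \<in> ?I" using l by (simp add: mdeg_def)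
  then have "?I \<noteq> {}" by blast
  moreover have "vanishes_to_order 2 (\<lambda>z :: real \<times> (real ^ 'n). case p of (j, k) \<Rightarrow>
      (fst z ^ j * (\<Prod>i\<in>UNIV. (snd z $ i) ^ k i)) *\<^sub>R c j k)" if "p \<in> ?I" for p
  proof -
    obtain j k where p: "p = (j, k)" by force
    have "vanishes_to_order (j * 1 + (\<Sum>i\<in>UNIV. k i * 1) + 0)
        (\<lambda>z :: real \<times> (real ^ 'n). fst z ^ j * (\<Prod>i\<in>UNIV. (snd z $ i) ^ k i) * c j k)"
      by (intro vanishes_to_order_mult vanishes_to_order_power vanishes_to_order_prod
          vanishes_to_order_linear vanishes_to_order_const bounded_linear_fst finite
          bounded_linear_compose[OF bounded_linear_vec_nth bounded_linear_snd])
    then show ?thesis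
      using that by (simp add: p mdeg_def vanishes_to_order_mono)
  qed
  ultimately have "vanishes_to_order 2 (\<lambda>z :: real \<times> (real ^ 'n). \<Sum>p\<in>?I. case p of (j, k) \<Rightarrow>
      (fst z ^ j * (\<Prod>i\<in>UNIV. (snd z $ i) ^ k i)) *\<^sub>R c j k)"
    by (rule vanishes_to_order_sum)
  then show ?thesis by (simp add: poly_xy_def case_prod_unfold)
qed

section \<open>The invariance equation\<close>

text \<open>A trajectory in the manifold satisfies \<open>y = w (x, x')\<close>, hence \<open>y' = x' w1 + a w2\<close> where \<open>w1\<close>, \<open>w2\<close> are the partial
  derivatives of \<open>w\<close> and \<open>a = x''\<close>. Differentiating once more, and inserting the result into the second equation
  of motion, gives an identity in the initial point alone. The last free ingredient is the derivative \<open>a'\<close> of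
  \<open>x''\<close> along the trajectory.\<close>

lemma invariance_equation:
  fixes w w1 w2 :: "real \<times> real \<Rightarrow> real ^ 'n" and M K :: "real ^ 'n ^ 'n"
  assumes inv: "locally_invariant \<omega> P M K Q (lsm_set \<omega> P U w)"
    and N: "open N" "(x, v) \<in> N" "(x, v) \<in> U"
    and w: "\<And>z. z \<in> N \<Longrightarrow> (w has_derivative (\<lambda>(h, k). h *\<^sub>R w1 z + k *\<^sub>R w2 z)) (at z)"
    and w1: "(w1 has_derivative (\<lambda>(h, k). h *\<^sub>R w11 + k *\<^sub>R w12)) (at (x, v))"
    and w2: "(w2 has_derivative (\<lambda>(h, k). h *\<^sub>R w21 + k *\<^sub>R w22)) (at (x, v))"
    and P: "((\<lambda>(x, y). P x y) has_derivative P') (at (x, w (x, v)))"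
  defines "a \<equiv> - \<omega>\<^sup>2 * x - P x (w (x, v))"
  defines "a' \<equiv> - \<omega>\<^sup>2 * v - P' (v, v *\<^sub>R w1 (x, v) + a *\<^sub>R w2 (x, v))"
  shows "M *v (a *\<^sub>R w1 (x, v) + v *\<^sub>R (v *\<^sub>R w11 + a *\<^sub>R w12) + a' *\<^sub>R w2 (x, v)
      + a *\<^sub>R (v *\<^sub>R w21 + a *\<^sub>R w22)) + K *v w (x, v) + Q x (w (x, v)) = 0"
proof -
  have "(x, v, w (x, v), time_deriv \<omega> P w (x, v)) \<in> lsm_set \<omega> P U w"
    using N by (simp add: lsm_set_def)
  then obtain \<epsilon> \<gamma> where \<epsilon>: "\<epsilon> > 0" and \<gamma>: "\<gamma> 0 = (x, v, w (x, v), time_deriv \<omega> P w (x, v))"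
    "trajectory_on \<omega> P M K Q {-\<epsilon><..<\<epsilon>} \<gamma>" "\<forall>t\<in>{-\<epsilon><..<\<epsilon>}. \<gamma> t \<in> lsm_set \<omega> P U w"
    using inv unfolding locally_invariant_def by blast
  obtain X V Y Z where XVYZ: "\<gamma> = (\<lambda>t. (X t, V t, Y t, Z t))"
    and ode: "\<forall>t\<in>{-\<epsilon><..<\<epsilon>}. \<exists>a b.
          (X has_real_derivative V t) (at t) \<and> (V has_real_derivative a) (at t) \<and>
          (Y has_vector_derivative Z t) (at t) \<and> (Z has_vector_derivative b) (at t) \<and>
          a + \<omega>\<^sup>2 * X t + P (X t) (Y t) = 0 \<and>
          M *v b + K *v Y t + Q (X t) (Y t) = 0"
    using \<gamma>(2) unfolding trajectory_on_def by blast
  have at0: "X 0 = x" "V 0 = v" "Y 0 = w (x, v)"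
    using \<gamma>(1) XVYZ by auto
  have on: "Y t = w (X t, V t)" "Z t = time_deriv \<omega> P w (X t, V t)" if "t \<in> {-\<epsilon><..<\<epsilon>}" for t
    using \<gamma>(3) that XVYZ by (auto simp: lsm_set_def)
  have td: "time_deriv \<omega> P w (x', v') = v' *\<^sub>R w1 (x', v') + (- \<omega>\<^sup>2 * x' - P x' (w (x', v'))) *\<^sub>R w2 (x', v')"
    if "(x', v') \<in> N" for x' v'
    using frechet_derivative_at[OF w[OF that], symmetric] by (simp add: time_deriv_def)
  obtain a0 b where X: "(X has_real_derivative v) (at 0)" and V: "(V has_real_derivative a0) (at 0)"
    and Y: "(Y has_vector_derivative Z 0) (at 0)" and Z: "(Z has_vector_derivative b) (at 0)"
    and a0: "a0 + \<omega>\<^sup>2 * x + P x (w (x, v)) = 0"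
    and b: "M *v b + K *v w (x, v) + Q x (w (x, v)) = 0"
    using bspec[OF ode, of 0] \<epsilon> by (auto simp: at0)
  have "a0 = a" using a0 by (simp add: a_def)
  have Z0: "Z 0 = v *\<^sub>R w1 (x, v) + a *\<^sub>R w2 (x, v)"
    using on(2)[of 0] \<epsilon> td[OF N(2)] by (simp add: at0 a_def)
  have X': "(X has_derivative (\<lambda>h. h * v)) (at 0)" and V': "(V has_derivative (\<lambda>h. h * a)) (at 0)"
    and Y': "(Y has_derivative (\<lambda>h. h *\<^sub>R Z 0)) (at 0)"
    using X V Y \<open>a0 = a\<close> by (simp_all add: has_field_derivative_def has_vector_derivative_def mult.commute[of _ v] mult.commute[of _ a])
  have XV: "((\<lambda>t. (X t, V t)) has_derivative (\<lambda>h. (h * v, h * a))) (at 0)"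
    and XY: "((\<lambda>t. (X t, Y t)) has_derivative (\<lambda>h. (h * v, h *\<^sub>R Z 0))) (at 0)"
    by (intro has_derivative_Pair X' V' Y')+
  have W1: "((\<lambda>t. w1 (X t, V t)) has_derivative (\<lambda>h. (h * v) *\<^sub>R w11 + (h * a) *\<^sub>R w12)) (at 0)"
    using has_derivative_compose[OF XV w1[folded at0(1,2)]] by simp
  have W2: "((\<lambda>t. w2 (X t, V t)) has_derivative (\<lambda>h. (h * v) *\<^sub>R w21 + (h * a) *\<^sub>R w22)) (at 0)"
    using has_derivative_compose[OF XV w2[folded at0(1,2)]] by simp
  have P'h: "P' (h * v, h *\<^sub>R Z 0) = h * P' (v, Z 0)" for h
    using linear_scale[OF has_derivative_linear[OF P], of h "(v, Z 0)"] by simp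
  have P1: "((\<lambda>t. P (X t) (Y t)) has_derivative (\<lambda>h. h * P' (v, Z 0))) (at 0)"
    using has_derivative_compose[OF XY, of "\<lambda>(x, y). P x y" P'] P by (simp add: at0 P'h)
  have a': "a' = - \<omega>\<^sup>2 * v - P' (v, Z 0)"
    by (simp add: a'_def Z0)
  have "((\<lambda>t. V t *\<^sub>R w1 (X t, V t) + (- \<omega>\<^sup>2 * X t - P (X t) (Y t)) *\<^sub>R w2 (X t, V t)) has_derivative
     (\<lambda>h. h *\<^sub>R (a *\<^sub>R w1 (x, v) + v *\<^sub>R (v *\<^sub>R w11 + a *\<^sub>R w12) + a' *\<^sub>R w2 (x, v)
      + a *\<^sub>R (v *\<^sub>R w21 + a *\<^sub>R w22)))) (at 0)"
    by (rule derivative_eq_intros V' W1 W2 P1 X' refl)+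
      (auto simp: fun_eq_iff at0 a_def a' algebra_simps)
  then have "(Z has_derivative
     (\<lambda>h. h *\<^sub>R (a *\<^sub>R w1 (x, v) + v *\<^sub>R (v *\<^sub>R w11 + a *\<^sub>R w12) + a' *\<^sub>R w2 (x, v)
      + a *\<^sub>R (v *\<^sub>R w21 + a *\<^sub>R w22)))) (at 0)"
  proof (rule has_derivative_transform_eventually)
    have "((\<lambda>t. (X t, V t)) \<longlongrightarrow> (x, v)) (at 0)"
      using has_derivative_continuous[OF XV] at0 by (simp add: isCont_def)
    then have "\<forall>\<^sub>F t in at 0. (X t, V t) \<in> N"
      using N(1,2) by (rule topological_tendstoD)
    moreover have "\<forall>\<^sub>F t in at 0. t \<in> {-\<epsilon><..<\<epsilon>}"
      using \<epsilon> by (intro eventually_at_in_open') auto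
    ultimately show "\<forall>\<^sub>F t in at 0. V t *\<^sub>R w1 (X t, V t) + (- \<omega>\<^sup>2 * X t - P (X t) (Y t)) *\<^sub>R w2 (X t, V t) = Z t"
      by eventually_elim (simp add: on td)
  qed (auto simp: Z0 at0 a_def)
  then have "b = a *\<^sub>R w1 (x, v) + v *\<^sub>R (v *\<^sub>R w11 + a *\<^sub>R w12) + a' *\<^sub>R w2 (x, v)
      + a *\<^sub>R (v *\<^sub>R w21 + a *\<^sub>R w22)"
    by (intro vector_derivative_unique_at[OF Z]) (simp add: has_vector_derivative_def)
  then show ?thesis using b by simp
qed

section \<open>The quadratic part of the invariance equation\<close>

text \<open>The second-order terms of the invariance equation are extracted by evaluating it at
  \<open>(s * x, s * v)\<close>, dividing by \<open>s\<^sup>2\<close>, and letting \<open>s\<close> tend to \<open>0\<close>. This lemma and the two after it supply the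
  limits of the factors.\<close>

lemma ray_quotient_tendsto:
  fixes g :: "real \<times> real \<Rightarrow> 'b::real_normed_vector"
  assumes g: "(g has_derivative (\<lambda>(h, k). h *\<^sub>R g1 + k *\<^sub>R g2)) (at (0, 0))" and 0: "g (0, 0) = 0"
  shows "((\<lambda>s. g (s * x, s * v) /\<^sub>R s) \<longlongrightarrow> x *\<^sub>R g1 + v *\<^sub>R g2) (at 0)"
proof -
  have "((\<lambda>s. (s * x, s * v)) has_derivative (\<lambda>h. (h * x, h * v))) (at 0)"
    by (intro has_derivative_Pair has_derivative_mult_left has_derivative_ident)
  from has_derivative_compose[OF this, of g "\<lambda>(h, k). h *\<^sub>R g1 + k *\<^sub>R g2"] g
  have "((\<lambda>s. g (s * x, s * v)) has_derivative (\<lambda>h. h *\<^sub>R (x *\<^sub>R g1 + v *\<^sub>R g2))) (at 0)"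
    by (simp add: scaleR_add_right)
  then have "((\<lambda>s. norm (g (s * x, s * v) - s *\<^sub>R (x *\<^sub>R g1 + v *\<^sub>R g2)) / norm s) \<longlongrightarrow> 0) (at 0)"
    unfolding has_derivative_at using 0 by simp
  moreover have "\<forall>\<^sub>F s in at 0. norm (g (s * x, s * v) - s *\<^sub>R (x *\<^sub>R g1 + v *\<^sub>R g2)) / norm s
      = norm (g (s * x, s * v) /\<^sub>R s - (x *\<^sub>R g1 + v *\<^sub>R g2))"
    using eventually_neq_at_within[of 0 0 UNIV]
  proof eventually_elim
    case s: (elim s)
    have "g (s * x, s * v) /\<^sub>R s - (x *\<^sub>R g1 + v *\<^sub>R g2)
        = (g (s * x, s * v) - s *\<^sub>R (x *\<^sub>R g1 + v *\<^sub>R g2)) /\<^sub>R s"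
      using s by (simp add: scaleR_diff_right)
    then show ?case
      by (simp add: divide_inverse mult.commute)
  qed
  ultimately have "((\<lambda>s. norm (g (s * x, s * v) /\<^sub>R s - (x *\<^sub>R g1 + v *\<^sub>R g2))) \<longlongrightarrow> 0) (at 0)"
    by (rule Lim_transform_eventually)
  then show ?thesis by (simp add: tendsto_norm_zero_iff LIM_zero_iff)
qed

lemma ray_tendsto: "((\<lambda>s. (s * x, s * v)) \<longlongrightarrow> (0, 0)) (at (0 :: real))" for x v :: real
  by (auto intro!: tendsto_eq_intros)

lemma quotient_tendsto_of_order:
  fixes g :: "real \<Rightarrow> 'b::real_normed_vector"
  assumes "\<forall>\<^sub>F s in at 0. norm (g s - s ^ k *\<^sub>R L) \<le> C * \<bar>s\<bar> ^ Suc k"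
  shows "((\<lambda>s. g s /\<^sub>R s ^ k) \<longlongrightarrow> L) (at 0)"
proof (rule LIM_zero_cancel, rule Lim_null_comparison)
  show "\<forall>\<^sub>F s in at 0. norm (g s /\<^sub>R s ^ k - L) \<le> C * \<bar>s\<bar>"
    using assms eventually_neq_at_within[of 0 0 UNIV]
  proof eventually_elim
    case (elim s)
    have "g s /\<^sub>R s ^ k - L = (g s - s ^ k *\<^sub>R L) /\<^sub>R s ^ k"
      using elim(2) by (simp add: scaleR_diff_right)
    then have "norm (g s /\<^sub>R s ^ k - L) = norm (g s - s ^ k *\<^sub>R L) / \<bar>s\<bar> ^ k"
      by (simp add: power_abs divide_inverse mult.commute)
    also have "\<dots> \<le> C * \<bar>s\<bar> ^ Suc k / \<bar>s\<bar> ^ k"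
      using elim(1) by (intro divide_right_mono) auto
    also have "\<dots> = C * \<bar>s\<bar>" using elim(2) by simp
    finally show ?case .
  qed
  show "((\<lambda>s. C * \<bar>s\<bar>) \<longlongrightarrow> 0) (at 0)"
    by (auto intro!: tendsto_eq_intros)
qed

text \<open>Tangency says that \<open>w\<close> has derivative zero at the origin.\<close>

lemma LSM_tangency:
  fixes w :: "real \<times> real \<Rightarrow> real ^ 'n"
  assumes LSM: "is_LSM \<omega> P M K Q U w" and w: "power_series2 c r w" and r: "0 < r"
  shows "c 0 0 = 0" "c 1 0 = 0" "c 0 1 = 0"
proof -
  show "c 0 0 = 0"
    using power_series2_at_0[OF w r] LSM by (simp add: is_LSM_def)
  obtain w1 w2 where w1: "power_series2 (\<lambda>i j. real (Suc i) *\<^sub>R c (Suc i) j) r w1"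
    and w2: "power_series2 (\<lambda>i j. real (Suc j) *\<^sub>R c i (Suc j)) r w2"
    and w': "\<And>x v. \<bar>x\<bar> < r \<Longrightarrow> \<bar>v\<bar> < r \<Longrightarrow>
       (w has_derivative (\<lambda>(h, k). h *\<^sub>R w1 (x, v) + k *\<^sub>R w2 (x, v))) (at (x, v))"
    using power_series2_has_derivative[OF w] by blast
  have "((\<lambda>z. (w z, time_deriv \<omega> P w z)) has_derivative (\<lambda>_. 0)) (at (0, 0))"
    using LSM by (simp add: is_LSM_def)
  from has_derivative_fst[OF this] have "(w has_derivative (\<lambda>_. 0)) (at (0, 0))"
    by simp
  then have "(\<lambda>(h, k). h *\<^sub>R w1 (0, 0) + k *\<^sub>R w2 (0, 0)) = (\<lambda>_. 0)"
    using w'[of 0 0] r by (intro has_derivative_unique) auto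
  then have "w1 (0, 0) = 0" "w2 (0, 0) = 0"
    by (auto dest: fun_cong[of _ _ "(1, 0)"] fun_cong[of _ _ "(0, 1)"])
  then show "c 1 0 = 0" "c 0 1 = 0"
    using power_series2_at_0[OF w1 r] power_series2_at_0[OF w2 r] by auto
qed

text \<open>The coefficients of \<open>w\<close> vanish below order 2, so the weighted expansion applies with \<open>t = norm (x, v)\<close>.\<close>

lemma poly_xy_on_graph:
  fixes w :: "real \<times> real \<Rightarrow> real ^ 'n" and d :: "nat \<Rightarrow> ('n \<Rightarrow> nat) \<Rightarrow> 'b::real_normed_vector"
  assumes w: "power_series2 c r w" and r: "0 < r"
    and low: "c 0 0 = 0" "c 1 0 = 0" "c 0 1 = 0"
    and l: "l \<le> 3" and high: "\<And>j k. j + mdeg k > l \<Longrightarrow> d j k = 0"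
  shows "\<exists>C \<delta>. \<delta> > 0 \<and> (\<forall>x v. norm (x, v) < \<delta> \<longrightarrow>
    norm (poly_xy l d x (w (x, v)) - (x\<^sup>2 *\<^sub>R d 2 (\<lambda>_. 0) + x ^ 3 *\<^sub>R d 3 (\<lambda>_. 0)
       + (\<Sum>i\<in>UNIV. (x * w (x, v) $ i) *\<^sub>R d 1 (unit_index i)))) \<le> C * norm (x, v) ^ 4)"
proof -
  have "c i j = 0" if "i + j < 2" for i j
    using that low by (cases i; cases j) auto
  from power_series2_order[OF w r this]
  obtain B \<delta> where \<delta>: "\<delta> > 0" and B: "\<And>z. norm z < \<delta> \<Longrightarrow> norm (w z) \<le> B * norm z ^ 2"
    by blast
  obtain C where C: "\<And>x y t. \<bar>x\<bar> \<le> t \<Longrightarrow> norm y \<le> max 1 B * t\<^sup>2 \<Longrightarrow> t \<le> 1 \<Longrightarrow>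
    norm (poly_xy l d x y - (x\<^sup>2 *\<^sub>R d 2 (\<lambda>_. 0) + x ^ 3 *\<^sub>R d 3 (\<lambda>_. 0)
       + (\<Sum>i\<in>UNIV. (x * y $ i) *\<^sub>R d 1 (unit_index i)))) \<le> C * t ^ 4"
    using poly_xy_weighted_expansion[where c = d, OF l high, of "max 1 B"] by auto
  show ?thesis
  proof (rule exI[of _ C], rule exI[of _ "min 1 \<delta>"], intro conjI allI impI)
    fix x v :: real assume z: "norm (x, v) < min 1 \<delta>"
    have "norm (w (x, v)) \<le> B * (norm (x, v))\<^sup>2" using B[of "(x, v)"] z by simp
    also have "\<dots> \<le> max 1 B * (norm (x, v))\<^sup>2" by (intro mult_right_mono) auto
    finally show "norm (poly_xy l d x (w (x, v)) - (x\<^sup>2 *\<^sub>R d 2 (\<lambda>_. 0) + x ^ 3 *\<^sub>R d 3 (\<lambda>_. 0)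
       + (\<Sum>i\<in>UNIV. (x * w (x, v) $ i) *\<^sub>R d 1 (unit_index i)))) \<le> C * norm (x, v) ^ 4"
      using z norm_fst_le[of x v] by (intro C) auto
  qed (use \<delta> in auto)
qed

text \<open>The quadratic homogeneous part of the invariance equation. To this order \<open>x''\<close> is \<open>- \<omega>\<^sup>2 x\<close>, its derivative
  is \<open>- \<omega>\<^sup>2 v\<close>, and \<open>w\<close> is its quadratic part: the nonlinearity \<open>P\<close> disappears and \<open>Q\<close> contributes only
  its coefficient at \<open>x\<^sup>2\<close>.\<close>

lemma LSM_quadratic_equation:
  fixes w :: "real \<times> real \<Rightarrow> real ^ 'n" and M K :: "real ^ 'n ^ 'n"
  assumes LSM: "is_LSM \<omega> (poly_xy l p) M K (poly_xy l q) U w"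
    and l: "2 \<le> l" "l \<le> 3" and high: "\<And>j k. j + mdeg k > l \<Longrightarrow> q j k = 0"
    and w: "power_series2 c r w" and r: "0 < r"
  shows "M *v ((- \<omega>\<^sup>2 * x) *\<^sub>R (x *\<^sub>R 2 *\<^sub>R c 2 0 + v *\<^sub>R c 1 1)
        + v *\<^sub>R (v *\<^sub>R 2 *\<^sub>R c 2 0 + (- \<omega>\<^sup>2 * x) *\<^sub>R c 1 1)
        + (- \<omega>\<^sup>2 * v) *\<^sub>R (x *\<^sub>R c 1 1 + v *\<^sub>R 2 *\<^sub>R c 0 2)
        + (- \<omega>\<^sup>2 * x) *\<^sub>R (v *\<^sub>R c 1 1 + (- \<omega>\<^sup>2 * x) *\<^sub>R 2 *\<^sub>R c 0 2))
      + K *v (x\<^sup>2 *\<^sub>R c 2 0 + (x * v) *\<^sub>R c 1 1 + v\<^sup>2 *\<^sub>R c 0 2) + x\<^sup>2 *\<^sub>R q 2 (\<lambda>_. 0) = 0"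
    (is "?E = 0")
proof -
  note low = LSM_tangency[OF LSM w r]
  have U: "open U" "(0, 0) \<in> U" and inv: "locally_invariant \<omega> (poly_xy l p) M K (poly_xy l q) (lsm_set \<omega> (poly_xy l p) U w)"
    and w0: "w (0, 0) = 0"
    using LSM by (auto simp: is_LSM_def)
  obtain w1 w2 where w1: "power_series2 (\<lambda>i j. real (Suc i) *\<^sub>R c (Suc i) j) r w1"
    and w2: "power_series2 (\<lambda>i j. real (Suc j) *\<^sub>R c i (Suc j)) r w2"
    and w': "\<And>x v. \<bar>x\<bar> < r \<Longrightarrow> \<bar>v\<bar> < r \<Longrightarrow>
       (w has_derivative (\<lambda>(h, k). h *\<^sub>R w1 (x, v) + k *\<^sub>R w2 (x, v))) (at (x, v))"
    using power_series2_has_derivative[OF w] by blast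
  obtain w11 w12 where w11: "power_series2 (\<lambda>i j. real (Suc i) *\<^sub>R real (Suc (Suc i)) *\<^sub>R c (Suc (Suc i)) j) r w11"
    and w12: "power_series2 (\<lambda>i j. real (Suc j) *\<^sub>R real (Suc i) *\<^sub>R c (Suc i) (Suc j)) r w12"
    and w1': "\<And>x v. \<bar>x\<bar> < r \<Longrightarrow> \<bar>v\<bar> < r \<Longrightarrow>
       (w1 has_derivative (\<lambda>(h, k). h *\<^sub>R w11 (x, v) + k *\<^sub>R w12 (x, v))) (at (x, v))"
    using power_series2_has_derivative[OF w1] by blast
  obtain w21 w22 where w21: "power_series2 (\<lambda>i j. real (Suc i) *\<^sub>R real (Suc j) *\<^sub>R c (Suc i) (Suc j)) r w21"
    and w22: "power_series2 (\<lambda>i j. real (Suc j) *\<^sub>R real (Suc (Suc j)) *\<^sub>R c i (Suc (Suc j))) r w22"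
    and w2': "\<And>x v. \<bar>x\<bar> < r \<Longrightarrow> \<bar>v\<bar> < r \<Longrightarrow>
       (w2 has_derivative (\<lambda>(h, k). h *\<^sub>R w21 (x, v) + k *\<^sub>R w22 (x, v))) (at (x, v))"
    using power_series2_has_derivative[OF w2] by blast
  have at0: "w1 (0, 0) = 0" "w2 (0, 0) = 0" "w11 (0, 0) = 2 *\<^sub>R c 2 0" "w12 (0, 0) = c 1 1"
    "w21 (0, 0) = c 1 1" "w22 (0, 0) = 2 *\<^sub>R c 0 2"
    using low power_series2_at_0[OF w1 r] power_series2_at_0[OF w2 r] power_series2_at_0[OF w11 r]
      power_series2_at_0[OF w12 r] power_series2_at_0[OF w21 r] power_series2_at_0[OF w22 r]
    by (simp_all add: numeral_2_eq_2)
  have continuous: "((\<lambda>s. g (s * x, s * v)) \<longlongrightarrow> g (0, 0)) (at 0)"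
    if g: "power_series2 b r g" for g b
  proof -
    obtain g1 g2 where "\<And>x v. \<bar>x\<bar> < r \<Longrightarrow> \<bar>v\<bar> < r \<Longrightarrow>
        (g has_derivative (\<lambda>(h, k). h *\<^sub>R g1 (x, v) + k *\<^sub>R g2 (x, v))) (at (x, v))"
      using power_series2_has_derivative[OF g] by blast
    from this[of 0 0] r have "isCont g (0, 0)" by (intro has_derivative_continuous) auto
    then show ?thesis by (rule isCont_tendsto_compose[OF _ ray_tendsto])
  qed
  obtain C P'' where P'': "\<And>z. norm z \<le> 1 \<Longrightarrow> ((\<lambda>(x, y). poly_xy l p x y) has_derivative P'' z) (at z)"
    and Pval: "\<And>z. norm z \<le> 1 \<Longrightarrow> \<bar>(\<lambda>(x, y). poly_xy l p x y) z\<bar> \<le> C * norm z ^ 2"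
    and P''bound: "\<And>z h. norm z \<le> 1 \<Longrightarrow> \<bar>P'' z h\<bar> \<le> C * norm z ^ (2 - 1) * norm h"
    using vanishes_to_order_poly_xy[OF l(1), of p] unfolding vanishes_to_order_def by blast
  \<comment> \<open>Quantities at the point \<open>(s * x, s * v)\<close>, with \<open>W1\<close> and \<open>W2\<close> already divided by \<open>s\<close>.\<close>
  define W where "W s = w (s * x, s * v)" for s
  define W1 where "W1 s = w1 (s * x, s * v) /\<^sub>R s" for s
  define W2 where "W2 s = w2 (s * x, s * v) /\<^sub>R s" for s
  define a where "a s = - \<omega>\<^sup>2 * (s * x) - poly_xy l p (s * x) (W s)" for s
  define u where "u s = (s * v) *\<^sub>R w1 (s * x, s * v) + a s *\<^sub>R w2 (s * x, s * v)" for s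
  define a' where "a' s = - \<omega>\<^sup>2 * (s * v) - P'' (s * x, W s) (s * v, u s)" for s
  have lim_w: "(W \<longlongrightarrow> 0) (at 0)"
    using continuous[OF w] w0 by (simp add: W_def[abs_def])
  have lim_w_s: "((\<lambda>s. W s /\<^sub>R s) \<longlongrightarrow> 0) (at 0)"
    using ray_quotient_tendsto[OF w'[of 0 0] w0] r at0 by (simp add: W_def)
  have lim_W1: "(W1 \<longlongrightarrow> x *\<^sub>R 2 *\<^sub>R c 2 0 + v *\<^sub>R c 1 1) (at 0)"
    using ray_quotient_tendsto[OF w1'[of 0 0] at0(1)] r unfolding at0 W1_def[abs_def] by auto
  have lim_W2: "(W2 \<longlongrightarrow> x *\<^sub>R c 1 1 + v *\<^sub>R 2 *\<^sub>R c 0 2) (at 0)"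
    using ray_quotient_tendsto[OF w2'[of 0 0] at0(2)] r unfolding at0 W2_def[abs_def] by auto
  have lim_w_s2: "((\<lambda>s. W s /\<^sub>R s ^ 2) \<longlongrightarrow> x\<^sup>2 *\<^sub>R c 2 0 + (x * v) *\<^sub>R c 1 1 + v\<^sup>2 *\<^sub>R c 0 2) (at 0)"
  proof -
    obtain D \<delta> where \<delta>: "\<delta> > 0" and D: "\<And>x v. norm (x, v) < \<delta> \<Longrightarrow>
     norm (w (x, v) - (x\<^sup>2 *\<^sub>R c 2 0 + (x * v) *\<^sub>R c 1 1 + v\<^sup>2 *\<^sub>R c 0 2)) \<le> D * norm (x, v) ^ 3"
      using power_series2_quadratic_part[OF w r low] by blast
    have "\<forall>\<^sub>F s in at 0. norm (s * x, s * v) < \<delta>"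
      using order_tendstoD(2)[OF tendsto_norm[OF ray_tendsto], of \<delta> x v] \<delta> by simp
    then have "\<forall>\<^sub>F s in at 0. norm (W s - s ^ 2 *\<^sub>R (x\<^sup>2 *\<^sub>R c 2 0 + (x * v) *\<^sub>R c 1 1 + v\<^sup>2 *\<^sub>R c 0 2))
        \<le> D * norm (x, v) ^ 3 * \<bar>s\<bar> ^ Suc 2"
    proof eventually_elim
      case (elim s)
      have "(s * x, s * v) = s *\<^sub>R (x, v)" by simp
      then have "norm (s * x, s * v) = \<bar>s\<bar> * norm (x, v)" by (simp only: norm_scaleR)
      with D[OF elim] show ?case
        by (simp add: W_def power_mult_distrib scaleR_add_right power2_eq_square mult_ac power3_eq_cube)
    qed
    then show ?thesis by (rule quotient_tendsto_of_order)
  qed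
  let ?\<xi> = "\<lambda>s. (s * x, W s)"
  have lim_\<xi>: "((\<lambda>s. norm (?\<xi> s)) \<longlongrightarrow> 0) (at 0)"
    by (intro tendsto_norm_zero) (auto intro!: tendsto_eq_intros lim_w simp: zero_prod_def)
  have small: "\<forall>\<^sub>F s in at 0. norm (?\<xi> s) \<le> 1"
    using order_tendstoD(2)[OF lim_\<xi>, of 1] by (auto elim: eventually_mono)
  have nz: "\<forall>\<^sub>F s in at 0. s \<noteq> (0 :: real)"
    by (rule eventually_neq_at_within)
  have lim_P: "((\<lambda>s. poly_xy l p (s * x) (W s) / s) \<longlongrightarrow> 0) (at 0)"
  proof (rule Lim_null_comparison)
    show "((\<lambda>s. C * norm (?\<xi> s) * norm (x, W s /\<^sub>R s)) \<longlongrightarrow> 0) (at 0)"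
      using tendsto_mult[OF tendsto_mult[OF tendsto_const[of C] lim_\<xi>]
          tendsto_norm[OF tendsto_Pair[OF tendsto_const[of x] lim_w_s]]] by simp
    show "\<forall>\<^sub>F s in at 0. norm (poly_xy l p (s * x) (W s) / s) \<le> C * norm (?\<xi> s) * norm (x, W s /\<^sub>R s)"
      using small nz
    proof eventually_elim
      case (elim s)
      have "(x, W s /\<^sub>R s) = ?\<xi> s /\<^sub>R s" using elim(2) by simp
      then have "norm (x, W s /\<^sub>R s) = norm (?\<xi> s) / \<bar>s\<bar>"
        by (simp only: norm_scaleR) (simp add: divide_inverse mult.commute)
      then show ?case
        using divide_right_mono[OF Pval[OF elim(1)], of "\<bar>s\<bar>"] by (simp add: power2_eq_square mult.assoc)
    qed
  qed
  have lim_a: "((\<lambda>s. a s / s) \<longlongrightarrow> - \<omega>\<^sup>2 * x) (at 0)"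
  proof (rule Lim_transform_eventually)
    show "((\<lambda>s. - \<omega>\<^sup>2 * x - poly_xy l p (s * x) (W s) / s) \<longlongrightarrow> - \<omega>\<^sup>2 * x) (at 0)"
      using tendsto_diff[OF tendsto_const lim_P] by simp
    show "\<forall>\<^sub>F s in at 0. - \<omega>\<^sup>2 * x - poly_xy l p (s * x) (W s) / s = a s / s"
      using nz by eventually_elim (simp add: a_def diff_divide_distrib)
  qed
  have lim_u: "((\<lambda>s. u s /\<^sub>R s) \<longlongrightarrow> 0) (at 0)"
  proof (rule Lim_transform_eventually)
    show "((\<lambda>s. v *\<^sub>R w1 (s * x, s * v) + (a s / s) *\<^sub>R w2 (s * x, s * v)) \<longlongrightarrow> 0) (at 0)"
      using tendsto_add[OF tendsto_scaleR[OF tendsto_const[of v] continuous[OF w1]]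
          tendsto_scaleR[OF lim_a continuous[OF w2]]] by (simp add: at0)
    show "\<forall>\<^sub>F s in at 0. v *\<^sub>R w1 (s * x, s * v) + (a s / s) *\<^sub>R w2 (s * x, s * v) = u s /\<^sub>R s"
      using nz by eventually_elim (simp add: u_def scaleR_add_right divide_inverse mult.commute)
  qed
  have lim_P'': "((\<lambda>s. P'' (?\<xi> s) (s * v, u s) / s) \<longlongrightarrow> 0) (at 0)"
  proof (rule Lim_null_comparison)
    show "((\<lambda>s. C * norm (?\<xi> s) * norm (v, u s /\<^sub>R s)) \<longlongrightarrow> 0) (at 0)"
      using tendsto_mult[OF tendsto_mult[OF tendsto_const[of C] lim_\<xi>]
          tendsto_norm[OF tendsto_Pair[OF tendsto_const[of v] lim_u]]] by simp
    show "\<forall>\<^sub>F s in at 0. norm (P'' (?\<xi> s) (s * v, u s) / s) \<le> C * norm (?\<xi> s) * norm (v, u s /\<^sub>R s)"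
      using small nz
    proof eventually_elim
      case (elim s)
      have "(v, u s /\<^sub>R s) = (s * v, u s) /\<^sub>R s" using elim(2) by simp
      then have "norm (v, u s /\<^sub>R s) = norm (s * v, u s) / \<bar>s\<bar>"
        by (simp only: norm_scaleR) (simp add: divide_inverse mult.commute)
      then show ?case
        using divide_right_mono[OF P''bound[OF elim(1), of "(s * v, u s)"], of "\<bar>s\<bar>"] by simp
    qed
  qed
  have lim_a': "((\<lambda>s. a' s / s) \<longlongrightarrow> - \<omega>\<^sup>2 * v) (at 0)"
  proof (rule Lim_transform_eventually)
    show "((\<lambda>s. - \<omega>\<^sup>2 * v - P'' (?\<xi> s) (s * v, u s) / s) \<longlongrightarrow> - \<omega>\<^sup>2 * v) (at 0)"
      using tendsto_diff[OF tendsto_const lim_P''] by simp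
    show "\<forall>\<^sub>F s in at 0. - \<omega>\<^sup>2 * v - P'' (?\<xi> s) (s * v, u s) / s = a' s / s"
      using nz by eventually_elim (simp add: a'_def diff_divide_distrib)
  qed
  have lim_Q: "((\<lambda>s. poly_xy l q (s * x) (W s) /\<^sub>R s ^ 2) \<longlongrightarrow> x\<^sup>2 *\<^sub>R q 2 (\<lambda>_. 0)) (at 0)"
  proof -
    let ?L = "\<lambda>s. (s * x)\<^sup>2 *\<^sub>R q 2 (\<lambda>_. 0) + (s * x) ^ 3 *\<^sub>R q 3 (\<lambda>_. 0)
         + (\<Sum>i\<in>UNIV. ((s * x) * W s $ i) *\<^sub>R q 1 (unit_index i))"
    obtain D \<delta> where \<delta>: "\<delta> > 0" and D: "\<And>x v. norm (x, v) < \<delta> \<Longrightarrow>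
      norm (poly_xy l q x (w (x, v)) - (x\<^sup>2 *\<^sub>R q 2 (\<lambda>_. 0) + x ^ 3 *\<^sub>R q 3 (\<lambda>_. 0)
         + (\<Sum>i\<in>UNIV. (x * w (x, v) $ i) *\<^sub>R q 1 (unit_index i)))) \<le> D * norm (x, v) ^ 4"
      using poly_xy_on_graph[OF w r low l(2), of q] high by blast
    have "\<forall>\<^sub>F s in at 0. norm (s * x, s * v) < \<delta>"
      using order_tendstoD(2)[OF tendsto_norm[OF ray_tendsto], of \<delta> x v] \<delta> by simp
    then have "\<forall>\<^sub>F s in at 0. norm ((poly_xy l q (s * x) (W s) - ?L s) - s ^ 3 *\<^sub>R 0)
        \<le> D * norm (x, v) ^ 4 * \<bar>s\<bar> ^ Suc 3"
    proof eventually_elim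
      case (elim s)
      have "(s * x, s * v) = s *\<^sub>R (x, v)" by simp
      then have "norm (s * x, s * v) = \<bar>s\<bar> * norm (x, v)" by (simp only: norm_scaleR)
      with D[OF elim] show ?case
        by (simp add: W_def power_mult_distrib mult_ac)
    qed
    then have "((\<lambda>s. (poly_xy l q (s * x) (W s) - ?L s) /\<^sub>R s ^ 3) \<longlongrightarrow> 0) (at 0)"
      by (rule quotient_tendsto_of_order)
    from tendsto_scaleR[OF tendsto_ident_at this]
    have rest: "((\<lambda>s. s *\<^sub>R ((poly_xy l q (s * x) (W s) - ?L s) /\<^sub>R s ^ 3)) \<longlongrightarrow> 0) (at 0)" by simp
    have main: "((\<lambda>s. x\<^sup>2 *\<^sub>R q 2 (\<lambda>_. 0) + (s * x ^ 3) *\<^sub>R q 3 (\<lambda>_. 0)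
         + (\<Sum>i\<in>UNIV. (x * (W s /\<^sub>R s) $ i) *\<^sub>R q 1 (unit_index i)))
        \<longlongrightarrow> x\<^sup>2 *\<^sub>R q 2 (\<lambda>_. 0) + (0 * x ^ 3) *\<^sub>R q 3 (\<lambda>_. 0)
         + (\<Sum>i\<in>UNIV. (x * 0 $ i) *\<^sub>R q 1 (unit_index i))) (at 0)"
      by (intro tendsto_intros tendsto_vec_nth lim_w_s)
    show ?thesis
    proof (rule Lim_transform_eventually)
      show "((\<lambda>s. s *\<^sub>R ((poly_xy l q (s * x) (W s) - ?L s) /\<^sub>R s ^ 3) + (x\<^sup>2 *\<^sub>R q 2 (\<lambda>_. 0) + (s * x ^ 3) *\<^sub>R q 3 (\<lambda>_. 0)
         + (\<Sum>i\<in>UNIV. (x * (W s /\<^sub>R s) $ i) *\<^sub>R q 1 (unit_index i)))) \<longlongrightarrow> x\<^sup>2 *\<^sub>R q 2 (\<lambda>_. 0)) (at 0)"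
        using tendsto_add[OF rest main] by simp
      show "\<forall>\<^sub>F s in at 0. s *\<^sub>R ((poly_xy l q (s * x) (W s) - ?L s) /\<^sub>R s ^ 3) + (x\<^sup>2 *\<^sub>R q 2 (\<lambda>_. 0) + (s * x ^ 3) *\<^sub>R q 3 (\<lambda>_. 0)
         + (\<Sum>i\<in>UNIV. (x * (W s /\<^sub>R s) $ i) *\<^sub>R q 1 (unit_index i))) = poly_xy l q (s * x) (W s) /\<^sub>R s ^ 2"
        using nz
      proof eventually_elim
        case (elim s)
        have L: "?L s /\<^sub>R s ^ 2 = x\<^sup>2 *\<^sub>R q 2 (\<lambda>_. 0) + (s * x ^ 3) *\<^sub>R q 3 (\<lambda>_. 0)
         + (\<Sum>i\<in>UNIV. (x * (W s /\<^sub>R s) $ i) *\<^sub>R q 1 (unit_index i))"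
          using elim by (simp add: scaleR_add_right scaleR_sum_right power2_eq_square power3_eq_cube field_simps)
        have s: "s *\<^sub>R (y /\<^sub>R s ^ 3) = y /\<^sub>R s ^ 2" for y :: "real ^ 'n"
          using elim by (simp add: power2_eq_square power3_eq_cube)
        show ?case
          unfolding s L[symmetric] by (simp add: scaleR_diff_right)
      qed
    qed
  qed
  \<comment> \<open>The invariance equation divided by \<open>s\<^sup>2\<close>, one factor \<open>s\<close> going to each of the two first-order factors
    of the products inside \<open>M *v _\<close>.\<close>
  define G where "G s = M *v ((a s / s) *\<^sub>R W1 s
        + v *\<^sub>R (v *\<^sub>R w11 (s * x, s * v) + (a s / s) *\<^sub>R w12 (s * x, s * v))
        + (a' s / s) *\<^sub>R W2 s
        + (a s / s) *\<^sub>R (v *\<^sub>R w21 (s * x, s * v) + (a s / s) *\<^sub>R w22 (s * x, s * v)))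
      + K *v (W s /\<^sub>R s ^ 2) + poly_xy l q (s * x) (W s) /\<^sub>R s ^ 2" for s
  have "(G \<longlongrightarrow> ?E) (at 0)"
    unfolding G_def[abs_def]
    by (intro tendsto_add bounded_linear.tendsto[OF matrix_vector_mul_bounded_linear] tendsto_scaleR
        tendsto_const lim_a lim_W1 lim_W2 lim_a' lim_w_s2 lim_Q
        continuous[OF w11, unfolded at0] continuous[OF w12, unfolded at0]
        continuous[OF w21, unfolded at0] continuous[OF w22, unfolded at0])
  moreover have "(G \<longlongrightarrow> 0) (at 0)"
  proof (rule tendsto_eventually)
    define N where "N = U \<inter> ({-r<..<r} \<times> {-r<..<r})"
    have N: "open N" "(0, 0) \<in> N" using U r by (auto simp: N_def open_Times)
    have "\<forall>\<^sub>F s in at 0. (s * x, s * v) \<in> N"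
      by (rule topological_tendstoD[OF ray_tendsto N])
    then show "\<forall>\<^sub>F s in at 0. G s = 0"
      using small nz
    proof eventually_elim
      case (elim s)
      have box: "\<bar>s * x\<bar> < r" "\<bar>s * v\<bar> < r" "(s * x, s * v) \<in> U" using elim(1) by (auto simp: N_def)
      have "M *v (a s *\<^sub>R w1 (s * x, s * v)
          + (s * v) *\<^sub>R ((s * v) *\<^sub>R w11 (s * x, s * v) + a s *\<^sub>R w12 (s * x, s * v))
          + a' s *\<^sub>R w2 (s * x, s * v)
          + a s *\<^sub>R ((s * v) *\<^sub>R w21 (s * x, s * v) + a s *\<^sub>R w22 (s * x, s * v)))
          + K *v W s + poly_xy l q (s * x) (W s) = 0"
        unfolding a_def a'_def u_def W_def
      proof (rule invariance_equation[OF inv N(1) elim(1) box(3) _ w1'[OF box(1,2)] w2'[OF box(1,2)]])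
        show "(w has_derivative (\<lambda>(h, k). h *\<^sub>R w1 z + k *\<^sub>R w2 z)) (at z)" if "z \<in> N" for z
          using w'[of "fst z" "snd z"] that by (cases z) (auto simp: N_def)
        show "((\<lambda>(x, y). poly_xy l p x y) has_derivative P'' (s * x, w (s * x, s * v))) (at (s * x, w (s * x, s * v)))"
          using P''[OF elim(2)] by (simp add: W_def)
      qed
      moreover define \<alpha> \<beta> where "\<alpha> = a s / s" and "\<beta> = a' s / s"
      moreover have "a s = s * \<alpha>" "a' s = s * \<beta>" "w1 (s * x, s * v) = s *\<^sub>R W1 s" "w2 (s * x, s * v) = s *\<^sub>R W2 s"
        using elim(3) by (simp_all add: \<alpha>_def \<beta>_def W1_def W2_def)
      ultimately have eq: "M *v ((s * \<alpha>) *\<^sub>R s *\<^sub>R W1 s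
          + (s * v) *\<^sub>R ((s * v) *\<^sub>R w11 (s * x, s * v) + (s * \<alpha>) *\<^sub>R w12 (s * x, s * v))
          + (s * \<beta>) *\<^sub>R s *\<^sub>R W2 s
          + (s * \<alpha>) *\<^sub>R ((s * v) *\<^sub>R w21 (s * x, s * v) + (s * \<alpha>) *\<^sub>R w22 (s * x, s * v)))
          + K *v W s + poly_xy l q (s * x) (W s) = 0"
        by metis
      have quad: "(s * \<alpha>) *\<^sub>R s *\<^sub>R W1 s
          + (s * v) *\<^sub>R ((s * v) *\<^sub>R w11 (s * x, s * v) + (s * \<alpha>) *\<^sub>R w12 (s * x, s * v))
          + (s * \<beta>) *\<^sub>R s *\<^sub>R W2 s
          + (s * \<alpha>) *\<^sub>R ((s * v) *\<^sub>R w21 (s * x, s * v) + (s * \<alpha>) *\<^sub>R w22 (s * x, s * v))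
        = s\<^sup>2 *\<^sub>R (\<alpha> *\<^sub>R W1 s
          + v *\<^sub>R (v *\<^sub>R w11 (s * x, s * v) + \<alpha> *\<^sub>R w12 (s * x, s * v))
          + \<beta> *\<^sub>R W2 s
          + \<alpha> *\<^sub>R (v *\<^sub>R w21 (s * x, s * v) + \<alpha> *\<^sub>R w22 (s * x, s * v)))"
        by (simp add: scaleR_add_right power2_eq_square mult_ac)
      have pull: "s\<^sup>2 *\<^sub>R (M *v y + K *v (W s /\<^sub>R s ^ 2) + poly_xy l q (s * x) (W s) /\<^sub>R s ^ 2)
          = M *v (s\<^sup>2 *\<^sub>R y) + K *v W s + poly_xy l q (s * x) (W s)" for y
        using elim(3) by (simp add: scaleR_add_right matrix_vector_mult_scaleR)
      have "s\<^sup>2 *\<^sub>R G s = 0"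
        using eq unfolding G_def \<alpha>_def[symmetric] \<beta>_def[symmetric] pull quad .
      then show "G s = 0" using elim(3) by simp
    qed
  qed
  ultimately show ?thesis
    by (intro tendsto_unique[of "at (0 :: real)" G]) auto
qed

section \<open>The linear system for the quadratic coefficients\<close>

lemma matrix_inv_mult:
  fixes A :: "real ^ 'n ^ 'n"
  assumes "invertible A"
  shows "A ** matrix_inv A = mat 1" "matrix_inv A ** A = mat 1"
  using assms unfolding invertible_def matrix_inv_def by (metis (mono_tags, lifting) someI_ex)+

lemma mat_vector_mult: "mat z *v x = z *\<^sub>R (x :: real ^ 'n)"
proof -
  have "(mat z :: real ^ 'n ^ 'n) = z *\<^sub>R mat 1"
    by (simp add: mat_def vec_eq_iff)
  then show ?thesis by (simp add: scaleR_matrix_vector_assoc[symmetric])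
qed

text \<open>The shift by \<open>(k \<omega>)\<^sup>2\<close> is singular only if some \<open>freq i\<close> equals \<open>k \<omega>\<close> or \<open>- k \<omega>\<close>. The cases \<open>k = 0\<close> and \<open>k = 2\<close>
  are the two inverses in the formulas for the coefficients.\<close>

lemma invertible_shift_of_nonresonant:
  fixes A :: "real ^ 'n ^ 'n"
  assumes ev: "eigenvalues_are A (\<lambda>i. (freq i)\<^sup>2)"
    and \<omega>: "\<omega> > 0" and nonres: "\<And>i. freq i / \<omega> \<notin> \<int>"
  shows "invertible (A - mat ((of_int k * \<omega>)\<^sup>2))"
proof -
  let ?z = "(of_int k * \<omega>)\<^sup>2"
  have "?z \<noteq> (freq i)\<^sup>2" for i
  proof
    assume "?z = (freq i)\<^sup>2"
    then have "freq i = of_int k * \<omega> \<or> freq i = - (of_int k * \<omega>)"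
      by (auto simp: power2_eq_iff)
    then have "freq i / \<omega> = of_int k \<or> freq i / \<omega> = of_int (- k)"
      using \<omega> by (auto simp: field_simps)
    then show False using nonres[of i] Ints_of_int by metis
  qed
  then have "det (mat ?z - A) \<noteq> 0"
    using ev by (simp add: eigenvalues_are_def)
  then obtain B where B: "(mat ?z - A) ** B = mat 1" "B ** (mat ?z - A) = mat 1"
    by (auto simp: invertible_det_nz[symmetric] invertible_def)
  have "(A - mat ?z) ** (- B) = mat 1" "(- B) ** (A - mat ?z) = mat 1"
  proof -
    show "(A - mat ?z) ** (- B) = mat 1"
      using B(1) by (simp add: matrix_matrix_mult_def vec_eq_iff algebra_simps sum_subtractf)
    show "(- B) ** (A - mat ?z) = mat 1"
      using B(2) by (simp add: matrix_matrix_mult_def vec_eq_iff algebra_simps sum_subtractf)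
  qed
  then show ?thesis unfolding invertible_def by blast
qed

text \<open>The second equation expresses \<open>w20\<close> through \<open>w02\<close>; substituting into the first, the terms in
  \<open>\<omega> ^ 4\<close> cancel and \<open>A *v (A *v w02 - (4 * \<omega>\<^sup>2) *\<^sub>R w02) = 2 *\<^sub>R m\<close> remains.\<close>

lemma quadratic_coefficient_system:
  fixes A :: "real ^ 'n ^ 'n"
  assumes inv: "invertible A" "invertible (A - mat (4 * \<omega>\<^sup>2))"
    and xx: "(2 * \<omega>^4) *\<^sub>R w02 - (2 * \<omega>\<^sup>2) *\<^sub>R w20 + A *v w20 + m = 0"
    and vv: "2 *\<^sub>R w20 - (2 * \<omega>\<^sup>2) *\<^sub>R w02 + A *v w02 = 0"
  shows "w20 = - ((A - mat (2 * \<omega>\<^sup>2)) *v (matrix_inv (A - mat (4 * \<omega>\<^sup>2)) *v (matrix_inv A *v m)))"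
    and "w02 = 2 *\<^sub>R (matrix_inv (A - mat (4 * \<omega>\<^sup>2)) *v (matrix_inv A *v m))"
proof -
  have w20: "w20 = \<omega>\<^sup>2 *\<^sub>R w02 - (1/2) *\<^sub>R (A *v w02)"
    unfolding vec_eq_iff
  proof
    fix i
    show "w20 $ i = (\<omega>\<^sup>2 *\<^sub>R w02 - (1/2) *\<^sub>R (A *v w02)) $ i"
      using arg_cong[OF vv, of "\<lambda>u. u $ i"] by (simp add: field_simps)
  qed
  have lin: "A *v (x + y) = A *v x + A *v y" "A *v (x - y) = A *v x - A *v y" "A *v (r *\<^sub>R x) = r *\<^sub>R (A *v x)" for x y r
    by (simp_all add: matrix_vector_right_distrib matrix_vector_mult_diff_distrib matrix_vector_mult_scaleR)
  have "A *v (A *v w02 - (4 * \<omega>\<^sup>2) *\<^sub>R w02) = 2 *\<^sub>R m"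
  proof -
    have "A *v w20 = \<omega>\<^sup>2 *\<^sub>R (A *v w02) - (1/2) *\<^sub>R (A *v (A *v w02))"
      by (subst w20) (simp add: lin)
    from xx[unfolded this, unfolded w20] have *: "(2 * \<omega>^4) *\<^sub>R w02 - (2 * \<omega>\<^sup>2) *\<^sub>R (\<omega>\<^sup>2 *\<^sub>R w02 - (1/2) *\<^sub>R (A *v w02))
        + (\<omega>\<^sup>2 *\<^sub>R (A *v w02) - (1/2) *\<^sub>R (A *v (A *v w02))) + m = 0"
      .
    show ?thesis unfolding lin vec_eq_iff
    proof
      fix i
      have "2 * \<omega>^4 * w02 $ i - 2 * \<omega>\<^sup>2 * (\<omega>\<^sup>2 * w02 $ i - (A *v w02) $ i / 2)
        + (\<omega>\<^sup>2 * (A *v w02) $ i - (A *v (A *v w02)) $ i / 2) + m $ i = 0"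
        using arg_cong[OF *, of "\<lambda>v. v $ i"] by simp
      then show "(A *v (A *v w02) - (4 * \<omega>\<^sup>2) *\<^sub>R (A *v w02)) $ i = (2 *\<^sub>R m) $ i"
        by (simp add: algebra_simps power4_eq_xxxx power2_eq_square)
    qed
  qed
  then have "matrix_inv A *v (A *v (A *v w02 - (4 * \<omega>\<^sup>2) *\<^sub>R w02)) = 2 *\<^sub>R (matrix_inv A *v m)"
    by (simp add: matrix_vector_mult_scaleR)
  then have "(A - mat (4 * \<omega>\<^sup>2)) *v w02 = 2 *\<^sub>R (matrix_inv A *v m)"
    using inv(1) by (simp add: matrix_vector_mul_assoc matrix_inv_mult matrix_vector_mult_diff_rdistrib mat_vector_mult)
  then have "matrix_inv (A - mat (4 * \<omega>\<^sup>2)) *v ((A - mat (4 * \<omega>\<^sup>2)) *v w02)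
      = matrix_inv (A - mat (4 * \<omega>\<^sup>2)) *v (2 *\<^sub>R (matrix_inv A *v m))"
    by simp
  then show w02: "w02 = 2 *\<^sub>R (matrix_inv (A - mat (4 * \<omega>\<^sup>2)) *v (matrix_inv A *v m))"
    using inv(2) by (simp add: matrix_vector_mul_assoc matrix_inv_mult matrix_vector_mult_scaleR)
  have "w20 = - ((A - mat (2 * \<omega>\<^sup>2)) *v ((1/2) *\<^sub>R w02))"
    by (subst w20) (simp add: matrix_vector_mult_diff_rdistrib mat_vector_mult matrix_vector_mult_scaleR scaleR_diff_right)
  then show "w20 = - ((A - mat (2 * \<omega>\<^sup>2)) *v (matrix_inv (A - mat (4 * \<omega>\<^sup>2)) *v (matrix_inv A *v m)))"
    by (subst (asm) w02) simp
qed

section \<open>The reduced model\<close>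

theorem theorem2p1:
  fixes M K \<Omega>2 :: "real ^ 'n ^ 'n"
    and \<omega> :: real
    and freq :: "'n \<Rightarrow> real"
    and l :: nat
    and p :: "nat \<Rightarrow> ('n \<Rightarrow> nat) \<Rightarrow> real"
    and q :: "nat \<Rightarrow> ('n \<Rightarrow> nat) \<Rightarrow> real ^ 'n"
    and P :: "real \<Rightarrow> real ^ 'n \<Rightarrow> real"
    and Q :: "real \<Rightarrow> real ^ 'n \<Rightarrow> real ^ 'n"
    and p1 w20 w02 :: "real ^ 'n"
    and U :: "(real \<times> real) set"
    and w :: "real \<times> real \<Rightarrow> real ^ 'n"
  assumes "invertible M" and "\<omega> > 0"
    and \<Omega>2_def: "\<Omega>2 = matrix_inv M ** K"
    and eigenvalues: "eigenvalues_are \<Omega>2 (\<lambda>i. (freq i)\<^sup>2)"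
    and l: "2 \<le> l" "l \<le> 3"
    and p_high: "\<And>j k. j + mdeg k > l \<Longrightarrow> p j k = 0"
    and q_high: "\<And>j k. j + mdeg k > l \<Longrightarrow> q j k = 0"
    and P_def: "P = poly_xy l p"
    and Q_def: "Q = poly_xy l q"
    and p1_def: "p1 = (\<chi> i. p 1 (unit_index i))"
    and nonresonance: "\<And>i. freq i / \<omega> \<notin> \<int>"
    and LSM: "is_LSM \<omega> P M K Q U w"
    and w20_def: "w20 = taylor_coeff w 2 0"
    and w02_def: "w02 = taylor_coeff w 0 2"
  shows "(\<exists>R \<in> O[nhds (0, 0)](\<lambda>z. norm z ^ 4). \<forall>(x, v) \<in> U. \<forall>a.
            reduced_model \<omega> P w x v a \<longleftrightarrow>
            a + \<omega>\<^sup>2 * x + p 2 (\<lambda>_. 0) * x ^ 2 + (p 3 (\<lambda>_. 0) + p1 \<bullet> w20) * x ^ 3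
              + (p1 \<bullet> w02) * (x * v ^ 2) + R (x, v) = 0)
       \<and> w20 = - (((\<Omega>2 - mat (2 * \<omega>\<^sup>2)) ** matrix_inv (\<Omega>2 - mat (4 * \<omega>\<^sup>2))
                    ** matrix_inv \<Omega>2 ** matrix_inv M) *v q 2 (\<lambda>_. 0))
       \<and> w02 = 2 *\<^sub>R ((matrix_inv (\<Omega>2 - mat (4 * \<omega>\<^sup>2))
                    ** matrix_inv \<Omega>2 ** matrix_inv M) *v q 2 (\<lambda>_. 0))"
proof -
  have U: "open U" "(0, 0) \<in> U" and "real_analytic2_on w U"
    using LSM by (auto simp: is_LSM_def)
  then obtain r c where r: "0 < r" and w: "power_series2 c r w"
    unfolding real_analytic2_on_def power_series2_def by fastforce
  note low = LSM_tangency[OF LSM w r]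
  have w20: "w20 = c 2 0" and w02: "w02 = c 0 2"
    using taylor_coeff_power_series2[OF w r] by (simp_all add: w20_def w02_def)
  define m where "m = matrix_inv M *v q 2 (\<lambda>_. 0)"
  have inv: "invertible \<Omega>2" "invertible (\<Omega>2 - mat (4 * \<omega>\<^sup>2))"
    using invertible_shift_of_nonresonant[OF eigenvalues \<open>\<omega> > 0\<close> nonresonance, of 0]
      invertible_shift_of_nonresonant[OF eigenvalues \<open>\<omega> > 0\<close> nonresonance, of 2]
    by (simp_all add: power_mult_distrib mat_0)
  \<comment> \<open>The quadratic part of the invariance equation, multiplied by the inverse of \<open>M\<close>.\<close>
  have eq: "(- \<omega>\<^sup>2 * x) *\<^sub>R (x *\<^sub>R 2 *\<^sub>R c 2 0 + v *\<^sub>R c 1 1)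
        + v *\<^sub>R (v *\<^sub>R 2 *\<^sub>R c 2 0 + (- \<omega>\<^sup>2 * x) *\<^sub>R c 1 1)
        + (- \<omega>\<^sup>2 * v) *\<^sub>R (x *\<^sub>R c 1 1 + v *\<^sub>R 2 *\<^sub>R c 0 2)
        + (- \<omega>\<^sup>2 * x) *\<^sub>R (v *\<^sub>R c 1 1 + (- \<omega>\<^sup>2 * x) *\<^sub>R 2 *\<^sub>R c 0 2)
      + \<Omega>2 *v (x\<^sup>2 *\<^sub>R c 2 0 + (x * v) *\<^sub>R c 1 1 + v\<^sup>2 *\<^sub>R c 0 2) + x\<^sup>2 *\<^sub>R m = 0"
    (is "?a x v + \<Omega>2 *v ?w x v + _ = 0") for x v
  proof -
    have "M *v ?a x v + K *v ?w x v + x\<^sup>2 *\<^sub>R q 2 (\<lambda>_. 0) = 0"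
      using LSM unfolding P_def Q_def by (rule LSM_quadratic_equation[OF _ l q_high w r])
    then have "matrix_inv M *v (M *v ?a x v + K *v ?w x v + x\<^sup>2 *\<^sub>R q 2 (\<lambda>_. 0)) = 0"
      by simp
    then show ?thesis
      by (simp only: matrix_vector_right_distrib matrix_vector_mult_scaleR matrix_vector_mul_assoc
          matrix_inv_mult[OF \<open>invertible M\<close>] matrix_vector_mul_lid \<Omega>2_def m_def)
  qed
  \<comment> \<open>Comparing coefficients of \<open>x\<^sup>2\<close>, \<open>v\<^sup>2\<close> and \<open>x * v\<close> amounts to evaluation at \<open>(1, 0)\<close>, \<open>(0, 1)\<close> and \<open>(1, 1)\<close>.\<close>
  have xx: "(2 * \<omega>^4) *\<^sub>R w02 - (2 * \<omega>\<^sup>2) *\<^sub>R w20 + \<Omega>2 *v w20 + m = 0"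
    using eq[of 1 0] by (simp add: w20 w02 power4_eq_xxxx power2_eq_square mult_ac)
  have vv: "2 *\<^sub>R w20 - (2 * \<omega>\<^sup>2) *\<^sub>R w02 + \<Omega>2 *v w02 = 0"
    using eq[of 0 1] by (simp add: w20 w02 mult_ac)
  have "\<Omega>2 *v c 1 1 - (4 * \<omega>\<^sup>2) *\<^sub>R c 1 1 = 0"
    unfolding vec_eq_iff
  proof
    fix i
    show "(\<Omega>2 *v c 1 1 - (4 * \<omega>\<^sup>2) *\<^sub>R c 1 1) $ i = 0 $ i"
      using arg_cong[OF eq[of 1 1], of "\<lambda>u. u $ i"] arg_cong[OF xx, of "\<lambda>u. u $ i"]
        arg_cong[OF vv, of "\<lambda>u. u $ i"]
      by (simp add: w20 w02 matrix_vector_right_distrib algebra_simps power4_eq_xxxx power2_eq_square)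
  qed
  then have "(\<Omega>2 - mat (4 * \<omega>\<^sup>2)) *v c 1 1 = 0"
    by (simp add: matrix_vector_mult_diff_rdistrib mat_vector_mult)
  then have "matrix_inv (\<Omega>2 - mat (4 * \<omega>\<^sup>2)) *v ((\<Omega>2 - mat (4 * \<omega>\<^sup>2)) *v c 1 1) = 0"
    by simp
  \<comment> \<open>The reduced model has no term in \<open>x\<^sup>2 * v\<close> because \<open>4 * \<omega>\<^sup>2\<close> is not an eigenvalue.\<close>
  then have w11: "c 1 1 = 0"
    using inv(2) by (simp add: matrix_vector_mul_assoc matrix_inv_mult)
  define R where "R = (\<lambda>(x, v). P x (w (x, v)) - (p 2 (\<lambda>_. 0) * x ^ 2
      + (p 3 (\<lambda>_. 0) + p1 \<bullet> w20) * x ^ 3 + (p1 \<bullet> w02) * (x * v ^ 2)))"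
  have "R \<in> O[nhds (0, 0)](\<lambda>z. norm z ^ 4)"
  proof -
    obtain C \<delta> where \<delta>: "\<delta> > 0" and C: "\<And>x v. norm (x, v) < \<delta> \<Longrightarrow>
      norm (poly_xy l p x (w (x, v)) - (x\<^sup>2 *\<^sub>R p 2 (\<lambda>_. 0) + x ^ 3 *\<^sub>R p 3 (\<lambda>_. 0)
         + (\<Sum>i\<in>UNIV. (x * w (x, v) $ i) *\<^sub>R p 1 (unit_index i)))) \<le> C * norm (x, v) ^ 4"
      using poly_xy_on_graph[OF w r low l(2), of p] p_high by blast
    obtain D \<delta>' where \<delta>': "\<delta>' > 0" and D: "\<And>x v. norm (x, v) < \<delta>' \<Longrightarrow>
     norm (w (x, v) - (x\<^sup>2 *\<^sub>R c 2 0 + (x * v) *\<^sub>R c 1 1 + v\<^sup>2 *\<^sub>R c 0 2)) \<le> D * norm (x, v) ^ 3"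
      using power_series2_quadratic_part[OF w r low] by blast
    have bound: "norm (R z) \<le> (C + norm p1 * D) * norm (norm z ^ 4)" if z: "norm z < min \<delta> \<delta>'" for z
    proof -
      obtain x v where xv: "z = (x, v)" by force
      let ?e = "w (x, v) - (x\<^sup>2 *\<^sub>R w20 + v\<^sup>2 *\<^sub>R w02)"
      have sum: "(\<Sum>i\<in>UNIV. (x * w (x, v) $ i) *\<^sub>R p 1 (unit_index i)) = x * (p1 \<bullet> w (x, v))"
        by (simp add: p1_def inner_vec_def sum_distrib_left mult_ac)
      have "R z = (poly_xy l p x (w (x, v)) - (x\<^sup>2 *\<^sub>R p 2 (\<lambda>_. 0) + x ^ 3 *\<^sub>R p 3 (\<lambda>_. 0)
         + x * (p1 \<bullet> w (x, v)))) + x * (p1 \<bullet> ?e)"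
        by (simp add: R_def xv P_def inner_diff_right inner_add_right algebra_simps power2_eq_square power3_eq_cube)
      also have "norm \<dots> \<le> C * norm z ^ 4 + norm z * (norm p1 * (D * norm z ^ 3))"
      proof (rule norm_triangle_le[OF add_mono])
        show "norm (poly_xy l p x (w (x, v)) - (x\<^sup>2 *\<^sub>R p 2 (\<lambda>_. 0) + x ^ 3 *\<^sub>R p 3 (\<lambda>_. 0)
         + x * (p1 \<bullet> w (x, v)))) \<le> C * norm z ^ 4"
          using C[of x v] z unfolding sum xv by simp
        have "\<bar>p1 \<bullet> ?e\<bar> \<le> norm p1 * norm ?e" by (rule Cauchy_Schwarz_ineq2)
        also have "\<dots> \<le> norm p1 * (D * norm z ^ 3)"
          using D[of x v] z by (intro mult_left_mono) (auto simp: w11[simplified] w20 w02 xv)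
        finally show "norm (x * (p1 \<bullet> ?e)) \<le> norm z * (norm p1 * (D * norm z ^ 3))"
          unfolding real_norm_def abs_mult using norm_fst_le[of x v] by (intro mult_mono) (auto simp: xv)
      qed
      also have "\<dots> = (C + norm p1 * D) * norm (norm z ^ 4)"
        by (simp add: algebra_simps power3_eq_cube power4_eq_xxxx)
      finally show ?thesis .
    qed
    have near: "\<forall>\<^sub>F z :: real \<times> real in nhds (0, 0). norm z < min \<delta> \<delta>'"
      using \<delta> \<delta>' unfolding eventually_nhds_metric
      by (intro exI[of _ "min \<delta> \<delta>'"]) (auto simp: dist_norm zero_prod_def[symmetric])
    show ?thesis
      by (rule bigoI[where c = "C + norm p1 * D"], rule eventually_mono[OF near]) (rule bound)
  qed
  moreover have "\<forall>(x, v) \<in> U. \<forall>a. reduced_model \<omega> P w x v a \<longleftrightarrow>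
      a + \<omega>\<^sup>2 * x + p 2 (\<lambda>_. 0) * x ^ 2 + (p 3 (\<lambda>_. 0) + p1 \<bullet> w20) * x ^ 3
        + (p1 \<bullet> w02) * (x * v ^ 2) + R (x, v) = 0"
    by (auto simp: reduced_model_def R_def)
  ultimately show ?thesis
    using quadratic_coefficient_system[OF inv xx vv]
    unfolding m_def matrix_vector_mul_assoc[symmetric] by blast
qed

end
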